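(* Let $M_2=\langle x,y\rangle$ be the free metabelian group with free basis $x,y$, put $c=[x,y]$, and write $a^z=z^{-1}az$. Then the elements $$g_1=c^{x^2y^7}(c^x)^{-1}(c^{xy^7})^{-1}c,\qquad g_2=c^{x^3y^7}(c^x)^{-1}(c^{x^2y^7})^{-1}c$$ of $M_2$ have the same distribution on every finite metabelian group, i.e. $N_{g_1,G}=N_{g_2,G}$ for every finite metabelian group $G$, but no automorphism of $M_2$ maps $g_1$ to $g_2$. In particular, it is not true that two elements of a free metabelian group of finite rank have the same distribution if and only if an automorphism maps one to the other.
   Context: $M_n=F_n/F_n''$ is the free metabelian group of rank $n$, where $F_n$ is the free group of rank $n$ and $F_n''$ its second derived subgroup. For $w\in M_n$, a finite metabelian group $G$ and $g\in G$, put $N_{w,G}(g)=|\{(a_1,\dots,a_n)\in G^n: w(a_1,\dots,a_n)=g\}|$, where $w(a_1,\dots,a_n)$ is the image of $w$ under the homomorphism $M_n\to G$ sending the $i$-th basis element to $a_i$. Elements $u,v\in M_n$ have the same distribution if $N_{u,G}=N_{v,G}$ as functions on $G$ for every finite metabelian group $G$. *)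

theory Defs
  imports "HOL-Algebra.Algebra"
begin

section \<open>Free groups\<close>

text \<open>The letter \<open>(i, True)\<close> stands for the \<open>i\<close>-th basis element and \<open>(i, False)\<close> for its
  inverse. The elements of the free group of rank \<open>n\<close> are the reduced words in the letters with
  index below \<open>n\<close>; the product reduces the concatenation of two words.\<close>

type_synonym letter = "nat \<times> bool"

definition letter_inv :: "letter \<Rightarrow> letter" where
  "letter_inv l = (fst l, \<not> snd l)"

definition reduced :: "letter list \<Rightarrow> bool" where
  "reduced w \<longleftrightarrow> successively (\<lambda>l l'. l' \<noteq> letter_inv l) w"

fun reduce_Cons :: "letter \<Rightarrow> letter list \<Rightarrow> letter list" where
  "reduce_Cons l [] = [l]"
| "reduce_Cons l (l' # w) = (if l' = letter_inv l then w else l # l' # w)"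

definition free_group :: "nat \<Rightarrow> letter list monoid" where
  "free_group n =
     \<lparr>carrier = {w. reduced w \<and> fst ` set w \<subseteq> {..<n}},
      monoid.mult = (\<lambda>u v. foldr reduce_Cons u v),
      one = []\<rparr>"


section \<open>Metabelian groups and distributions of words\<close>

definition second_derived :: "('a, 'b) monoid_scheme \<Rightarrow> 'a set" where
  "second_derived G = derived G (derived G (carrier G))"

definition metabelian_group :: "('a, 'b) monoid_scheme \<Rightarrow> bool" where
  "metabelian_group G \<longleftrightarrow> group G \<and> second_derived G = {\<one>\<^bsub>G\<^esub>}"

definition free_metabelian :: "nat \<Rightarrow> letter list set monoid" where
  "free_metabelian n = free_group n Mod second_derived (free_group n)"

definition basis_elem :: "nat \<Rightarrow> nat \<Rightarrow> letter list set" where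
  "basis_elem n i = second_derived (free_group n) #>\<^bsub>free_group n\<^esub> [(i, True)]"

text \<open>\<open>eval_at n G a w\<close> is \<open>w(a\<^sub>1, \<dots>, a\<^sub>n)\<close>, with the tuple given as a function on
  \<open>{..<n}\<close>. The description is proper for metabelian \<open>G\<close>: see \<open>eval_at_unique\<close> below.\<close>

definition eval_at ::
    "nat \<Rightarrow> ('a, 'b) monoid_scheme \<Rightarrow> (nat \<Rightarrow> 'a) \<Rightarrow> letter list set \<Rightarrow> 'a" where
  "eval_at n G a w =
     (THE z. \<exists>h \<in> hom (free_metabelian n) G. (\<forall>i<n. h (basis_elem n i) = a i) \<and> h w = z)"

definition num_solutions ::
    "nat \<Rightarrow> ('a, 'b) monoid_scheme \<Rightarrow> letter list set \<Rightarrow> 'a \<Rightarrow> nat" where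
  "num_solutions n G w g = card {a \<in> {..<n} \<rightarrow>\<^sub>E carrier G. eval_at n G a w = g}"

text \<open>A finite group is isomorphic to one whose elements are natural numbers, so it suffices to
  quantify over groups of type \<open>nat monoid\<close>: see \<open>same_distribution_all_types\<close> below.\<close>

definition same_distribution :: "nat \<Rightarrow> letter list set \<Rightarrow> letter list set \<Rightarrow> bool" where
  "same_distribution n u v \<longleftrightarrow>
     (\<forall>G :: nat monoid. metabelian_group G \<and> finite (carrier G) \<longrightarrow>
        (\<forall>g \<in> carrier G. num_solutions n G u g = num_solutions n G v g))"


section \<open>The two elements\<close>

definition conjugate :: "('a, 'b) monoid_scheme \<Rightarrow> 'a \<Rightarrow> 'a \<Rightarrow> 'a" where
  "conjugate G a z = inv\<^bsub>G\<^esub> z \<otimes>\<^bsub>G\<^esub> a \<otimes>\<^bsub>G\<^esub> z"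

definition commutator :: "('a, 'b) monoid_scheme \<Rightarrow> 'a \<Rightarrow> 'a \<Rightarrow> 'a" where
  "commutator G a b = inv\<^bsub>G\<^esub> a \<otimes>\<^bsub>G\<^esub> inv\<^bsub>G\<^esub> b \<otimes>\<^bsub>G\<^esub> a \<otimes>\<^bsub>G\<^esub> b"

definition elem_g1 :: "letter list set" where
  "elem_g1 =
    (let M = free_metabelian 2; x = basis_elem 2 0; y = basis_elem 2 1; c = commutator M x y in
       conjugate M c (x [^]\<^bsub>M\<^esub> (2::nat) \<otimes>\<^bsub>M\<^esub> y [^]\<^bsub>M\<^esub> (7::nat))
       \<otimes>\<^bsub>M\<^esub> inv\<^bsub>M\<^esub> (conjugate M c x)
       \<otimes>\<^bsub>M\<^esub> inv\<^bsub>M\<^esub> (conjugate M c (x \<otimes>\<^bsub>M\<^esub> y [^]\<^bsub>M\<^esub> (7::nat)))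
       \<otimes>\<^bsub>M\<^esub> c)"

definition elem_g2 :: "letter list set" where
  "elem_g2 =
    (let M = free_metabelian 2; x = basis_elem 2 0; y = basis_elem 2 1; c = commutator M x y in
       conjugate M c (x [^]\<^bsub>M\<^esub> (3::nat) \<otimes>\<^bsub>M\<^esub> y [^]\<^bsub>M\<^esub> (7::nat))
       \<otimes>\<^bsub>M\<^esub> inv\<^bsub>M\<^esub> (conjugate M c x)
       \<otimes>\<^bsub>M\<^esub> inv\<^bsub>M\<^esub> (conjugate M c (x [^]\<^bsub>M\<^esub> (2::nat) \<otimes>\<^bsub>M\<^esub> y [^]\<^bsub>M\<^esub> (7::nat)))
       \<otimes>\<^bsub>M\<^esub> c)"


section \<open>The definitions behave as intended\<close>

lemma letter_inv_inv [simp]: "letter_inv (letter_inv l) = l"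
  by (simp add: letter_inv_def)

lemma fst_letter_inv [simp]: "fst (letter_inv l) = fst l"
  by (simp add: letter_inv_def)

lemma letter_inv_neq [simp]: "letter_inv l \<noteq> l" "l \<noteq> letter_inv l"
  by (cases l; auto simp: letter_inv_def)+

lemma reduced_Nil [simp]: "reduced []"
  by (simp add: reduced_def)

lemma reduced_ConsD: "reduced (l # w) \<Longrightarrow> reduced w"
  by (cases w) (auto simp: reduced_def)

lemma reduced_reduce_Cons: "reduced w \<Longrightarrow> reduced (reduce_Cons l w)"
  by (cases w) (auto simp: reduced_def dest: reduced_ConsD[unfolded reduced_def])

lemma reduce_Cons_reduced: "reduced (l # w) \<Longrightarrow> reduce_Cons l w = l # w"
  by (cases w) (auto simp: reduced_def)

lemma reduce_Cons_cancel: "reduced w \<Longrightarrow> reduce_Cons l (reduce_Cons (letter_inv l) w) = w"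
proof (cases w)
  case (Cons l' v)
  assume "reduced w"
  then show ?thesis
    using Cons reduce_Cons_reduced[of l v] by (cases v) auto
qed auto

lemma reduced_foldr: "reduced w \<Longrightarrow> reduced (foldr reduce_Cons u w)"
  by (induction u) (auto intro: reduced_reduce_Cons)

lemma set_reduce_Cons: "set (reduce_Cons l w) \<subseteq> insert l (set w)"
  by (cases w) auto

lemma set_foldr: "set (foldr reduce_Cons u w) \<subseteq> set u \<union> set w"
  by (induction u) (use set_reduce_Cons in \<open>fastforce+\<close>)

lemma foldr_reduce_Cons:
  assumes "reduced w"
  shows "foldr reduce_Cons (reduce_Cons l v) w = reduce_Cons l (foldr reduce_Cons v w)"
proof (cases v)
  case (Cons l' v')
  show ?thesis
  proof (cases "l' = letter_inv l")
    case True
    then show ?thesis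
      using Cons reduce_Cons_cancel[OF reduced_foldr[OF assms, of v'], of l] by simp
  qed (simp add: Cons)
qed simp

lemma foldr_foldr_reduce_Cons:
  "reduced w \<Longrightarrow> foldr reduce_Cons (foldr reduce_Cons u v) w
     = foldr reduce_Cons u (foldr reduce_Cons v w)"
  by (induction u) (auto simp: foldr_reduce_Cons)

lemma foldr_inverse_word:
  "reduced w \<Longrightarrow> foldr reduce_Cons (rev (map letter_inv w)) w = []"
  by (induction w) (auto dest: reduced_ConsD)

lemma group_free_group: "group (free_group n)"
proof (rule groupI)
  fix u v assume "u \<in> carrier (free_group n)" "v \<in> carrier (free_group n)"
  then show "u \<otimes>\<^bsub>free_group n\<^esub> v \<in> carrier (free_group n)"
    using set_foldr[of u v] by (fastforce simp: free_group_def intro: reduced_foldr)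
next
  fix w assume w: "w \<in> carrier (free_group n)"
  define v where "v = foldr reduce_Cons (rev (map letter_inv w)) []"
  have "v \<in> carrier (free_group n)"
    using w set_foldr[of "rev (map letter_inv w)" "[]"]
    by (fastforce simp: free_group_def v_def intro: reduced_foldr)
  moreover have "v \<otimes>\<^bsub>free_group n\<^esub> w = \<one>\<^bsub>free_group n\<^esub>"
    using w by (simp add: free_group_def v_def foldr_foldr_reduce_Cons foldr_inverse_word)
  ultimately show "\<exists>v \<in> carrier (free_group n). v \<otimes>\<^bsub>free_group n\<^esub> w = \<one>\<^bsub>free_group n\<^esub>"
    by blast
qed (auto simp: free_group_def foldr_foldr_reduce_Cons)

lemma normal_second_derived: "group G \<Longrightarrow> second_derived G \<lhd> G"
  unfolding second_derived_def
  by (intro group.derived_is_normal group.derived_self_is_normal)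

lemma group_free_metabelian: "group (free_metabelian n)"
  unfolding free_metabelian_def
  by (intro normal.factorgroup_is_group normal_second_derived group_free_group)

lemma basis_elem_closed:
  assumes "i < n" shows "basis_elem n i \<in> carrier (free_metabelian n)"
proof -
  have "[(i, True)] \<in> carrier (free_group n)"
    using assms by (simp add: free_group_def reduced_def)
  then show ?thesis
    by (auto simp: basis_elem_def free_metabelian_def carrier_FactGroup)
qed

lemma second_derived_img:
  assumes "group_hom G H h"
  shows "second_derived (H\<lparr>carrier := h ` carrier G\<rparr>) = h ` second_derived G"
    and "h ` second_derived G \<subseteq> second_derived H"
proof -
  interpret group_hom G H h by fact
  have D: "derived G (carrier G) \<subseteq> carrier G"
    by (intro G.derived_in_carrier) simp
  have img: "h ` second_derived G = derived H (derived H (h ` carrier G))"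
    by (simp add: second_derived_def derived_img D)
  have sub: "subgroup (h ` carrier G) H"
    by (intro subgroup_img_is_subgroup G.subgroup_self)
  show "second_derived (H\<lparr>carrier := h ` carrier G\<rparr>) = h ` second_derived G"
    unfolding img unfolding second_derived_def
    using H.derived_consistent[OF subset_refl sub]
      H.derived_consistent[OF H.derived_incl[OF subset_refl sub] sub] by simp
  have "h ` carrier G \<subseteq> carrier H"
    by (auto intro: hom_closed)
  then show "h ` second_derived G \<subseteq> second_derived H"
    unfolding img unfolding second_derived_def by (intro H.mono_derived)
qed

lemma metabelian_free_metabelian: "metabelian_group (free_metabelian n)"
proof -
  define F where "F = free_group n"
  define N where "N = second_derived F"
  interpret F: group F by (simp add: F_def group_free_group)
  interpret N: normal N F by (simp add: N_def normal_second_derived F.group_axioms)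
  have M: "free_metabelian n = F Mod N"
    by (simp add: free_metabelian_def F_def N_def)
  have hom: "group_hom F (F Mod N) (\<lambda>w. N #>\<^bsub>F\<^esub> w)"
    by (simp add: group_hom_def group_hom_axioms_def F.group_axioms
        N.factorgroup_is_group N.r_coset_hom_Mod)
  have surj: "(\<lambda>w. N #>\<^bsub>F\<^esub> w) ` carrier F = carrier (F Mod N)"
    by (simp add: carrier_FactGroup)
  have "second_derived (F Mod N) = (\<lambda>w. N #>\<^bsub>F\<^esub> w) ` N"
    using second_derived_img(1)[OF hom, unfolded surj] by (simp flip: N_def)
  also have "\<dots> = {N}"
  proof -
    have "N #>\<^bsub>F\<^esub> u = N" if "u \<in> N" for u
      using N.rcos_const[OF F.group_axioms that] .
    then have "(\<lambda>u. N #>\<^bsub>F\<^esub> u) ` N = (\<lambda>u. N) ` N"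
      by (intro image_cong) auto
    also have "\<dots> = {N}"
      using N.one_closed by (intro image_constant)
    finally show ?thesis .
  qed
  finally show ?thesis
    using N.factorgroup_is_group by (simp add: M metabelian_group_def)
qed

definition letter_value :: "('a, 'b) monoid_scheme \<Rightarrow> (nat \<Rightarrow> 'a) \<Rightarrow> letter \<Rightarrow> 'a" where
  "letter_value G a l = (if snd l then a (fst l) else inv\<^bsub>G\<^esub> (a (fst l)))"

definition word_value :: "('a, 'b) monoid_scheme \<Rightarrow> (nat \<Rightarrow> 'a) \<Rightarrow> letter list \<Rightarrow> 'a" where
  "word_value G a w = foldr (\<lambda>l z. letter_value G a l \<otimes>\<^bsub>G\<^esub> z) w \<one>\<^bsub>G\<^esub>"

lemma word_value_hom:
  assumes "group G" and a: "\<And>i. i < n \<Longrightarrow> a i \<in> carrier G"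
  shows "word_value G a \<in> hom (free_group n) G"
proof -
  interpret group G by fact
  have lv: "letter_value G a l \<in> carrier G" if "fst l < n" for l
    using that a by (simp add: letter_value_def)
  have lvi: "letter_value G a (letter_inv l) = inv\<^bsub>G\<^esub> (letter_value G a l)" if "fst l < n" for l
    using that a by (simp add: letter_value_def letter_inv_def)
  have closed: "word_value G a w \<in> carrier G" if "fst ` set w \<subseteq> {..<n}" for w
    using that by (induction w) (auto simp: word_value_def intro!: lv)
  have cons: "word_value G a (l # w) = letter_value G a l \<otimes>\<^bsub>G\<^esub> word_value G a w" for l w
    by (simp add: word_value_def)
  have rc: "word_value G a (reduce_Cons l w) = letter_value G a l \<otimes>\<^bsub>G\<^esub> word_value G a w"
    if "fst l < n" "fst ` set w \<subseteq> {..<n}" for l w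
  proof (cases w)
    case (Cons l' v)
    then show ?thesis
      using that closed[of v] lv[of l]
      by (auto simp: cons lvi m_assoc[symmetric])
  qed (simp add: cons)
  have mult: "word_value G a (foldr reduce_Cons u v) = word_value G a u \<otimes>\<^bsub>G\<^esub> word_value G a v"
    if "fst ` set u \<subseteq> {..<n}" "fst ` set v \<subseteq> {..<n}" for u v
    using that(1)
  proof (induction u)
    case Nil
    then show ?case using closed[OF that(2)] by (simp add: word_value_def)
  next
    case (Cons l u)
    have "fst ` set (foldr reduce_Cons u v) \<subseteq> {..<n}"
      using Cons.prems that(2) set_foldr[of u v] by fastforce
    then show ?case
      using Cons closed[of u] closed[OF that(2)] lv[of l] by (simp add: rc cons m_assoc)
  qed
  show ?thesis
    by (rule homI) (auto simp: free_group_def closed mult)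
qed

lemma free_metabelian_universal:
  assumes "metabelian_group G" and a: "\<And>i. i < n \<Longrightarrow> a i \<in> carrier G"
  shows "\<exists>h \<in> hom (free_metabelian n) G. \<forall>i<n. h (basis_elem n i) = a i"
proof -
  interpret G: group G using assms(1) by (simp add: metabelian_group_def)
  define F where "F = free_group n"
  define N where "N = second_derived F"
  interpret F: group F by (simp add: F_def group_free_group)
  interpret N: normal N F by (simp add: N_def normal_second_derived F.group_axioms)
  have f: "word_value G a \<in> hom F G"
    unfolding F_def by (intro word_value_hom a G.group_axioms)
  interpret f: group_hom F G "word_value G a"
    by unfold_locales (rule f)
  have ker: "word_value G a u = \<one>\<^bsub>G\<^esub>" if "u \<in> N" for u
    using second_derived_img(2)[OF f.group_hom_axioms] that assms(1)
    by (auto simp: N_def metabelian_group_def)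
  have factors: "word_value G a u = word_value G a v"
    if uv: "u \<in> carrier F" "v \<in> carrier F" "N #>\<^bsub>F\<^esub> u = N #>\<^bsub>F\<^esub> v" for u v
  proof -
    have "u \<in> N #>\<^bsub>F\<^esub> v"
      using F.rcos_self[OF uv(1) N.subgroup_axioms] uv(3) by simp
    then obtain z where z: "z \<in> N" "u = z \<otimes>\<^bsub>F\<^esub> v"
      by (auto simp: r_coset_def)
    then show ?thesis
      using uv ker[of z] N.subset by auto
  qed
  obtain h where h: "h \<in> hom (F Mod N) G"
      "\<And>u. u \<in> carrier F \<Longrightarrow> h (N #>\<^bsub>F\<^esub> u) = word_value G a u"
    using FactGroup_universal[OF f N.normal_axioms factors] by blast
  have "h (basis_elem n i) = a i" if "i < n" for i
    using h(2)[of "[(i, True)]"] that a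
    by (simp add: basis_elem_def flip: F_def N_def)
      (simp add: F_def free_group_def reduced_def word_value_def letter_value_def)
  then show ?thesis
    using h(1) by (auto simp: free_metabelian_def F_def N_def)
qed

lemma free_metabelian_hom_eqI:
  assumes "group G" and h: "h \<in> hom (free_metabelian n) G" and k: "k \<in> hom (free_metabelian n) G"
    and eq: "\<And>i. i < n \<Longrightarrow> h (basis_elem n i) = k (basis_elem n i)"
    and w: "w \<in> carrier (free_metabelian n)"
  shows "h w = k w"
proof -
  interpret G: group G by fact
  define F where "F = free_group n"
  define N where "N = second_derived F"
  interpret F: group F by (simp add: F_def group_free_group)
  interpret N: normal N F by (simp add: N_def normal_second_derived F.group_axioms)
  define q where "q = (\<lambda>u. N #>\<^bsub>F\<^esub> u)"
  have q: "q \<in> hom F (F Mod N)"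
    unfolding q_def by (rule N.r_coset_hom_Mod)
  have M: "free_metabelian n = F Mod N"
    by (simp add: free_metabelian_def F_def N_def)
  interpret h: group_hom F G "\<lambda>u. h (q u)"
    using hom_compose[OF q h[unfolded M]] by unfold_locales (simp add: comp_def)
  interpret k: group_hom F G "\<lambda>u. k (q u)"
    using hom_compose[OF q k[unfolded M]] by unfold_locales (simp add: comp_def)
  have single: "[l] \<in> carrier F" if "fst l < n" for l
    using that by (simp add: F_def free_group_def reduced_def)
  have pos: "h (q [(i, True)]) = k (q [(i, True)])" if "i < n" for i
    using eq[OF that] by (simp add: basis_elem_def q_def F_def N_def)
  have neg: "[(i, False)] = inv\<^bsub>F\<^esub> [(i, True)]" if "i < n" for i
  proof (rule F.inv_equality[symmetric])
    show "[(i, False)] \<otimes>\<^bsub>F\<^esub> [(i, True)] = \<one>\<^bsub>F\<^esub>"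
      by (simp add: F_def free_group_def letter_inv_def)
  qed (use that single in auto)
  have letter: "h (q [l]) = k (q [l])" if "fst l < n" for l
  proof (cases l)
    case (Pair i b)
    then show ?thesis
      using that single[of "(i, True)"] by (cases b) (auto simp: pos neg)
  qed
  have word: "h (q u) = k (q u)" if "reduced u" "fst ` set u \<subseteq> {..<n}" for u
    using that
  proof (induction u)
    case Nil
    have "[] = \<one>\<^bsub>F\<^esub>" by (simp add: F_def free_group_def)
    then show ?case by (metis h.hom_one k.hom_one)
  next
    case (Cons l u)
    have u: "u \<in> carrier F"
      using Cons.prems by (auto simp: F_def free_group_def dest: reduced_ConsD)
    have l: "[l] \<in> carrier F" "h (q [l]) = k (q [l])"
      using Cons.prems single letter by auto
    have lu: "l # u = [l] \<otimes>\<^bsub>F\<^esub> u"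
      using Cons.prems by (simp add: F_def free_group_def reduce_Cons_reduced)
    have "h (q u) = k (q u)"
      using Cons by (auto dest: reduced_ConsD)
    then show ?case
      unfolding lu by (simp add: h.hom_mult[OF l(1) u] k.hom_mult[OF l(1) u] l(2))
  qed
  obtain u where "u \<in> carrier F" "w = q u"
    using w by (auto simp: M carrier_FactGroup q_def)
  then show ?thesis
    using word[of u] by (simp add: F_def free_group_def)
qed

lemma eval_at_eqI:
  assumes "group G" "h \<in> hom (free_metabelian n) G" "\<And>i. i < n \<Longrightarrow> h (basis_elem n i) = a i"
    and "w \<in> carrier (free_metabelian n)"
  shows "eval_at n G a w = h w"
  unfolding eval_at_def
proof (rule the_equality)
  show "\<exists>k \<in> hom (free_metabelian n) G. (\<forall>i<n. k (basis_elem n i) = a i) \<and> k w = h w"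
    using assms by blast
next
  fix z assume "\<exists>k \<in> hom (free_metabelian n) G. (\<forall>i<n. k (basis_elem n i) = a i) \<and> k w = z"
  then obtain k where "k \<in> hom (free_metabelian n) G" "\<forall>i<n. k (basis_elem n i) = a i" "k w = z"
    by blast
  then show "z = h w"
    using free_metabelian_hom_eqI[OF assms(1) _ assms(2) _ assms(4), of k] assms(3) by simp
qed

lemma eval_at_unique:
  assumes "metabelian_group G" "\<And>i. i < n \<Longrightarrow> a i \<in> carrier G"
    and "w \<in> carrier (free_metabelian n)"
  shows "\<exists>!z. \<exists>h \<in> hom (free_metabelian n) G. (\<forall>i<n. h (basis_elem n i) = a i) \<and> h w = z"
proof -
  have G: "group G" using assms(1) by (simp add: metabelian_group_def)
  obtain h where h: "h \<in> hom (free_metabelian n) G" "\<forall>i<n. h (basis_elem n i) = a i"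
    using free_metabelian_universal[of G n a, OF assms(1,2)] by blast
  show ?thesis
  proof (rule ex1I[of _ "h w"])
    fix z assume "\<exists>k \<in> hom (free_metabelian n) G. (\<forall>i<n. k (basis_elem n i) = a i) \<and> k w = z"
    then obtain k where "k \<in> hom (free_metabelian n) G" "\<forall>i<n. k (basis_elem n i) = a i" "k w = z"
      by blast
    then show "z = h w"
      using free_metabelian_hom_eqI[OF G _ h(1) _ assms(3), of k] h(2) by simp
  qed (rule bexI[of _ h], use h in simp_all)
qed

lemma num_solutions_iso:
  assumes G: "metabelian_group G" and H: "group H" and f: "f \<in> iso G H"
    and g: "g \<in> carrier G" and w: "w \<in> carrier (free_metabelian n)"
  shows "num_solutions n H w (f g) = num_solutions n G w g"
proof -
  interpret G: group G using G by (simp add: metabelian_group_def)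
  interpret H: group H by fact
  have fh: "f \<in> hom G H" and bij: "bij_betw f (carrier G) (carrier H)"
    using f by (auto simp: iso_def)
  have ev: "eval_at n H (\<lambda>i\<in>{..<n}. f (a i)) w = f (eval_at n G a w)"
    and cl: "eval_at n G a w \<in> carrier G"
    if a: "a \<in> {..<n} \<rightarrow>\<^sub>E carrier G" for a
  proof -
    obtain h where h: "h \<in> hom (free_metabelian n) G" "\<forall>i<n. h (basis_elem n i) = a i"
      using free_metabelian_universal[OF G, of n a] a by auto
    have 1: "eval_at n G a w = h w"
      by (rule eval_at_eqI) (use h w G.group_axioms in auto)
    have fh': "(f \<circ> h) (basis_elem n i) = (\<lambda>i\<in>{..<n}. f (a i)) i" if "i < n" for i
      using h(2) that by simp
    have "eval_at n H (\<lambda>i\<in>{..<n}. f (a i)) w = (f \<circ> h) w"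
      by (rule eval_at_eqI) (fact H.group_axioms hom_compose[OF h(1) fh] fh' w)+
    then show "eval_at n H (\<lambda>i\<in>{..<n}. f (a i)) w = f (eval_at n G a w)"
      unfolding 1 by simp
    show "eval_at n G a w \<in> carrier G"
      using h(1) w 1 by (auto simp: hom_def)
  qed
  define T where "T = (\<lambda>a. \<lambda>i\<in>{..<n}. f (a i))"
  have inj: "inj_on T ({..<n} \<rightarrow>\<^sub>E carrier G)"
  proof (rule inj_onI)
    fix a b assume a: "a \<in> {..<n} \<rightarrow>\<^sub>E carrier G" and b: "b \<in> {..<n} \<rightarrow>\<^sub>E carrier G"
      and ab: "T a = T b"
    show "a = b"
    proof (rule PiE_ext[OF a b])
      fix i assume i: "i \<in> {..<n}"
      have "T a i = T b i" using ab by simp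
      then have "f (a i) = f (b i)" using i by (simp add: T_def)
      then show "a i = b i"
        using bij a b i by (auto simp: bij_betw_def inj_on_def dest!: PiE_mem[of _ _ _ i])
    qed
  qed
  have img: "T ` {a \<in> {..<n} \<rightarrow>\<^sub>E carrier G. eval_at n G a w = g}
      = {b \<in> {..<n} \<rightarrow>\<^sub>E carrier H. eval_at n H b w = f g}" (is "T ` ?A = ?B")
  proof (intro equalityI subsetI)
    fix b assume "b \<in> T ` ?A"
    then show "b \<in> ?B"
      using fh by (auto simp: T_def ev hom_def)
  next
    fix b assume b: "b \<in> ?B"
    define a where "a = (\<lambda>i\<in>{..<n}. inv_into (carrier G) f (b i))"
    have bi: "b i \<in> f ` carrier G" if "i < n" for i
      using b bij that by (auto simp: bij_betw_def)
    have a: "a \<in> {..<n} \<rightarrow>\<^sub>E carrier G"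
      by (auto simp: a_def intro!: inv_into_into bi)
    have "T a = b"
    proof (rule PiE_ext[of _ "{..<n}" "\<lambda>_. carrier H"])
      show "T a \<in> {..<n} \<rightarrow>\<^sub>E carrier H"
        using a fh by (auto simp: T_def hom_def)
      show "b \<in> {..<n} \<rightarrow>\<^sub>E carrier H"
        using b by simp
      show "T a i = b i" if "i \<in> {..<n}" for i
        using that bi[of i] by (simp add: T_def a_def f_inv_into_f)
    qed
    moreover have "eval_at n G a w = g"
      using b ev[OF a] cl[OF a] g bij \<open>T a = b\<close>
      by (auto simp: T_def bij_betw_def inj_on_def)
    ultimately show "b \<in> T ` ?A"
      using a by blast
  qed
  have "inj_on T ?A"
    using inj by (rule inj_on_subset) auto
  then show ?thesis
    unfolding num_solutions_def img[symmetric] by (rule card_image)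
qed

lemma same_distribution_all_types:
  fixes G :: "('a, 'b) monoid_scheme"
  assumes uv: "same_distribution n u v"
    and u: "u \<in> carrier (free_metabelian n)" and v: "v \<in> carrier (free_metabelian n)"
    and G: "metabelian_group G" "finite (carrier G)" and g: "g \<in> carrier G"
  shows "num_solutions n G u g = num_solutions n G v g"
proof -
  interpret G: group G using G(1) by (simp add: metabelian_group_def)
  obtain f :: "'a \<Rightarrow> nat" where f: "inj_on f (carrier G)"
    using G(2) finite_imp_inj_to_nat_seg by blast
  define H where "H = image_group f G"
  have fi: "f \<in> iso G H"
    unfolding H_def by (rule inj_imp_image_group_iso[OF f])
  have H: "group H"
    unfolding H_def by (rule G.inj_imp_image_group_is_group[OF f])
  have cH: "carrier H = f ` carrier G"
    by (simp add: H_def image_group_carrier)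
  interpret f: group_hom G H f
    using fi H by (simp add: group_hom_def group_hom_axioms_def iso_def G.group_axioms)
  have "second_derived H = {\<one>\<^bsub>H\<^esub>}"
    using second_derived_img(1)[OF f.group_hom_axioms] G(1)
    by (simp add: metabelian_group_def flip: cH)
  then have "metabelian_group H" "finite (carrier H)"
    using H G(2) by (auto simp: metabelian_group_def cH)
  then have "num_solutions n H u (f g) = num_solutions n H v (f g)"
    using uv g by (auto simp: same_distribution_def cH)
  then show ?thesis
    by (simp add: num_solutions_iso[OF G(1) H fi g] u v)
qed

end

(* Write G' additively, as a module over the group ring. With c = [x, y], both elements have the form
   (x - 1)(v - 1) c, where v = x y^7 or v = x^2 y^7. When (a, b) runs over G' x G', the values at
   (x a, y b) are spread uniformly over (x - 1)(v - 1)(c + J), where J = (x - 1) G' + (y - 1) G'.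
   If i t = 1 modulo |G|, replacing (x, y) by (x^i, y^t) fixes c modulo J and, for
   v = x^p y^7 with p = 2 t^2, turns v into (x^2 y^7)^t. As (x^n - 1) = n (x - 1) modulo
   (x - 1)^2, the coset does not change. So p = 2 and p = 2 t^2 give equal distributions; with t = 2
   modulo 7 we have p = 1 modulo 7, and y -> x^k y links this p to p = 1.

   An automorphism induces an integer matrix of determinant 1 or -1 on exponent sums. Homomorphisms to
   the affine group of the real line that do not kill c detect exactly the zeros of
   (x - 1)(x^p y^7 - 1), and comparing the zeros gives 2 = 1 or 2 = -1 modulo 7. *)

theory Submission
  imports Defs "HOL-Number_Theory.Cong"
begin

section \<open>Conjugates and commutators in arbitrary groups\<close>

lemma (in group) inv_mult_cancel:
  "\<lbrakk>x \<in> carrier G; y \<in> carrier G\<rbrakk> \<Longrightarrow> x \<otimes> (inv x \<otimes> y) = y"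
  "\<lbrakk>x \<in> carrier G; y \<in> carrier G\<rbrakk> \<Longrightarrow> inv x \<otimes> (x \<otimes> y) = y"
  by (simp_all flip: m_assoc)

lemma (in group) conjugate_closed [simp]:
  "\<lbrakk>a \<in> carrier G; u \<in> carrier G\<rbrakk> \<Longrightarrow> conjugate G a u \<in> carrier G"
  by (simp add: conjugate_def)

lemma (in group) commutator_closed [simp]:
  "\<lbrakk>a \<in> carrier G; b \<in> carrier G\<rbrakk> \<Longrightarrow> commutator G a b \<in> carrier G"
  by (simp add: commutator_def)

lemma (in group) conjugate_mult_right:
  "\<lbrakk>a \<in> carrier G; u \<in> carrier G; v \<in> carrier G\<rbrakk>
    \<Longrightarrow> conjugate G a (u \<otimes> v) = conjugate G (conjugate G a u) v"
  by (simp add: conjugate_def m_assoc inv_mult_group)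

lemma (in group) conjugate_mult_left:
  "\<lbrakk>a \<in> carrier G; b \<in> carrier G; u \<in> carrier G\<rbrakk>
    \<Longrightarrow> conjugate G (a \<otimes> b) u = conjugate G a u \<otimes> conjugate G b u"
  by (simp add: conjugate_def m_assoc inv_mult_cancel)

lemma (in group) conjugate_inv:
  "\<lbrakk>a \<in> carrier G; u \<in> carrier G\<rbrakk> \<Longrightarrow> conjugate G (inv a) u = inv (conjugate G a u)"
  by (simp add: conjugate_def m_assoc inv_mult_group)

lemma (in group) conjugate_one [simp]: "a \<in> carrier G \<Longrightarrow> conjugate G a \<one> = a"
  by (simp add: conjugate_def)

lemma (in group) conjugate_one_left [simp]: "u \<in> carrier G \<Longrightarrow> conjugate G \<one> u = \<one>"
  by (simp add: conjugate_def)

section \<open>The derived subgroup of a metabelian group as a module\<close>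

locale metabelian = group G for G (structure) +
  assumes second_derived: "second_derived G = {\<one>}"
begin

definition A where "A = derived G (carrier G)"

text \<open>In additive notation this is the group ring element u - 1 acting on the module
  \<open>A\<close>.\<close>

definition delta where "delta u a = conjugate G a u \<otimes> inv a"

lemma normal_A: "A \<lhd> G"
  unfolding A_def by (rule derived_self_is_normal)

lemma subgroup_A: "subgroup A G"
  by (rule normal_imp_subgroup[OF normal_A])

lemma A_carrier [simp]: "a \<in> A \<Longrightarrow> a \<in> carrier G"
  using subgroup.mem_carrier[OF subgroup_A] .

lemma A_mult [simp]: "\<lbrakk>a \<in> A; b \<in> A\<rbrakk> \<Longrightarrow> a \<otimes> b \<in> A"
  using subgroup.m_closed[OF subgroup_A] .

lemma A_inv [simp]: "a \<in> A \<Longrightarrow> inv a \<in> A"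
  using subgroup.m_inv_closed[OF subgroup_A] .

lemma A_one [simp]: "\<one> \<in> A"
  using subgroup.one_closed[OF subgroup_A] .

lemma A_pow [simp]: "a \<in> A \<Longrightarrow> a [^] (n::nat) \<in> A"
  by (induction n) simp_all

text \<open>The commutators of elements of \<open>A\<close> generate the second derived subgroup,
  which is trivial.\<close>

lemma A_commute: assumes "a \<in> A" "b \<in> A" shows "a \<otimes> b = b \<otimes> a"
proof -
  have "a \<otimes> b \<otimes> inv a \<otimes> inv b \<in> derived G A"
    unfolding derived_def using assms by (intro generate.incl) auto
  then have "a \<otimes> b \<otimes> inv a \<otimes> inv b = \<one>"
    using second_derived by (simp add: second_derived_def A_def)
  then have "a \<otimes> b \<otimes> inv (b \<otimes> a) = \<one>"
    using assms by (simp add: inv_mult_group m_assoc)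
  then show ?thesis
    using assms inv_equality[of "a \<otimes> b" "inv (b \<otimes> a)"] by simp
qed

lemma A_left_commute: "\<lbrakk>a \<in> A; b \<in> A; c \<in> A\<rbrakk> \<Longrightarrow> a \<otimes> (b \<otimes> c) = b \<otimes> (a \<otimes> c)"
  using A_commute[of a b] by (simp flip: m_assoc)

lemmas A_ac = m_assoc A_commute A_left_commute

lemma A_pow_mult: "\<lbrakk>a \<in> A; b \<in> A\<rbrakk> \<Longrightarrow> (a \<otimes> b) [^] (n::nat) = a [^] n \<otimes> b [^] n"
  using pow_mult_distrib[of a b n] A_commute[of a b] by simp

lemma conjugate_A [simp]: "\<lbrakk>a \<in> A; u \<in> carrier G\<rbrakk> \<Longrightarrow> conjugate G a u \<in> A"
  using normal.inv_op_closed1[OF normal_A] by (simp add: conjugate_def)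

lemma commutator_A [simp]:
  assumes "a \<in> carrier G" "b \<in> carrier G" shows "commutator G a b \<in> A"
proof -
  \<comment> \<open>The set \<open>derived\<close> is generated by the words a b a^-1 b^-1, whereas
    \<open>commutator\<close> puts the inverses first; hence the generator at the inverses of
    \<open>a\<close> and \<open>b\<close>.\<close>
  have "inv a \<otimes> inv b \<otimes> inv (inv a) \<otimes> inv (inv b) \<in> A"
    unfolding A_def derived_def using assms
    by (intro generate.incl UN_I[of "inv a"] UN_I[of "inv b"]) auto
  then show ?thesis using assms by (simp add: commutator_def)
qed

lemma conjugate_A_A: "\<lbrakk>a \<in> A; b \<in> A\<rbrakk> \<Longrightarrow> conjugate G a b = a"
  using A_commute[of a b] by (simp add: conjugate_def m_assoc inv_mult_cancel)

text \<open>Coarser than congruence modulo \<open>A\<close>, but all that \<open>delta\<close> can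
  see. It allows powers of x and y to be rearranged as if x and y commuted.\<close>

definition same_action where
  "same_action u v \<longleftrightarrow> u \<in> carrier G \<and> v \<in> carrier G \<and> (\<forall>a\<in>A. conjugate G a u = conjugate G a v)"

lemma same_action_refl: "u \<in> carrier G \<Longrightarrow> same_action u u"
  by (simp add: same_action_def)

lemma same_action_sym: "same_action u v \<Longrightarrow> same_action v u"
  by (simp add: same_action_def)

lemma same_action_trans [trans]: "same_action u v \<Longrightarrow> same_action v w \<Longrightarrow> same_action u w"
  by (simp add: same_action_def)

lemma same_action_mult: "same_action u v \<Longrightarrow> same_action u' v' \<Longrightarrow> same_action (u \<otimes> u') (v \<otimes> v')"
  by (simp add: same_action_def conjugate_mult_right)

lemma same_action_pow: "same_action u v \<Longrightarrow> same_action (u [^] (n::nat)) (v [^] n)"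
  by (induction n) (auto intro: same_action_mult same_action_refl)

text \<open>The two products differ by a commutator, and this acts trivially on the abelian group
  \<open>A\<close>.\<close>

lemma same_action_commute:
  assumes "u \<in> carrier G" "v \<in> carrier G" shows "same_action (u \<otimes> v) (v \<otimes> u)"
proof -
  have eq: "u \<otimes> v = v \<otimes> u \<otimes> commutator G u v"
    using assms by (simp add: commutator_def m_assoc inv_mult_cancel)
  show ?thesis
    using assms by (simp add: same_action_def eq conjugate_mult_right conjugate_A_A)
qed

lemma same_action_mult_A: "\<lbrakk>u \<in> carrier G; a \<in> A\<rbrakk> \<Longrightarrow> same_action (u \<otimes> a) u"
  by (simp add: same_action_def conjugate_mult_right conjugate_A_A)

lemma same_action_pow_mult:
  assumes u: "u \<in> carrier G" and v: "v \<in> carrier G"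
  shows "same_action ((u \<otimes> v) [^] (n::nat)) (u [^] n \<otimes> v [^] n)"
proof (induction n)
  case (Suc n)
  have "same_action ((u \<otimes> v) [^] Suc n) (u [^] n \<otimes> v [^] n \<otimes> (u \<otimes> v))"
    using u v Suc by (auto intro!: same_action_mult same_action_refl)
  also have "u [^] n \<otimes> v [^] n \<otimes> (u \<otimes> v) = u [^] n \<otimes> (v [^] n \<otimes> u) \<otimes> v"
    using u v by (simp add: m_assoc)
  also have "same_action \<dots> (u [^] n \<otimes> (u \<otimes> v [^] n) \<otimes> v)"
    using u v by (intro same_action_mult same_action_refl same_action_commute) auto
  also have "\<dots> = u [^] Suc n \<otimes> v [^] Suc n"
    using u v by (simp add: m_assoc)
  finally show ?case .
qed (simp add: same_action_refl)

lemma delta_A [simp]: "\<lbrakk>u \<in> carrier G; a \<in> A\<rbrakk> \<Longrightarrow> delta u a \<in> A"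
  by (simp add: delta_def)

lemma delta_same_action: "\<lbrakk>same_action u v; a \<in> A\<rbrakk> \<Longrightarrow> delta u a = delta v a"
  by (simp add: delta_def same_action_def)

lemma delta_mult:
  "\<lbrakk>u \<in> carrier G; a \<in> A; b \<in> A\<rbrakk> \<Longrightarrow> delta u (a \<otimes> b) = delta u a \<otimes> delta u b"
  by (simp add: delta_def conjugate_mult_left inv_mult_group A_ac)

lemma delta_one [simp]: "u \<in> carrier G \<Longrightarrow> delta u \<one> = \<one>"
  by (simp add: delta_def)

lemma conjugate_eq_delta: "\<lbrakk>u \<in> carrier G; a \<in> A\<rbrakk> \<Longrightarrow> conjugate G a u = delta u a \<otimes> a"
  by (simp add: delta_def m_assoc)

text \<open>The expansion (u - 1)(v - 1) = uv - u - v + 1, with its terms in the order in which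
  \<open>elem_g1\<close> and \<open>elem_g2\<close> are written.\<close>

lemma delta_delta:
  assumes "u \<in> carrier G" "v \<in> carrier G" "a \<in> A"
  shows "delta u (delta v a)
    = conjugate G a (u \<otimes> v) \<otimes> inv (conjugate G a u) \<otimes> inv (conjugate G a v) \<otimes> a"
proof -
  have "conjugate G a (u \<otimes> v) = conjugate G a (v \<otimes> u)"
    using same_action_commute[of u v] assms by (simp add: same_action_def)
  then show ?thesis
    using assms by (simp add: delta_def conjugate_mult_left conjugate_inv
        conjugate_mult_right inv_mult_group A_ac)
qed

lemma delta_commute:
  assumes "u \<in> carrier G" "v \<in> carrier G" "a \<in> A"
  shows "delta u (delta v a) = delta v (delta u a)"
  using assms same_action_commute[of u v] by (simp add: delta_delta same_action_def A_ac)

lemma delta_group_mult: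
  assumes "u \<in> carrier G" "v \<in> carrier G" "a \<in> A"
  shows "delta (u \<otimes> v) a = conjugate G (delta u a) v \<otimes> delta v a"
  using assms by (simp add: delta_def conjugate_mult_right conjugate_mult_left conjugate_inv
      A_ac inv_mult_cancel)

text \<open>In the group ring, u^n - 1 = (u - 1)(n + (u - 1) q) for a polynomial q in u, and
  \<open>b\<close> is q applied to \<open>a\<close>. For u in the role of x or v below, the
  correction (u - 1) b lies in \<open>J\<close>.\<close>

lemma delta_group_pow:
  assumes u: "u \<in> carrier G" and a: "a \<in> A"
  shows "\<exists>b\<in>A. delta (u [^] n) a = delta u (a [^] (n::nat) \<otimes> delta u b)"
proof (induction n)
  case 0
  show ?case using u a by (intro bexI[of _ \<one>]) (simp_all add: delta_def)
next
  case (Suc n)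
  then obtain b where b: "b \<in> A" "delta (u [^] n) a = delta u (a [^] n \<otimes> delta u b)" by blast
  let ?m = "a [^] n \<otimes> delta u b"
  have "delta (u [^] Suc n) a = delta u (delta u ?m) \<otimes> delta u ?m \<otimes> delta u a"
    using u a b by (simp add: delta_group_mult conjugate_eq_delta)
  also have "\<dots> = delta u (a [^] Suc n \<otimes> delta u (?m \<otimes> b))"
    using u a b by (simp add: delta_mult A_ac)
  \<comment> \<open>With m = n a + (u - 1) b, the sum m + (u - 1) m + a equals (n + 1) a + (u - 1)(m
    + b), which gives the next witness.\<close>
  finally show ?case using u a b by (intro bexI[of _ "?m \<otimes> b"]) auto
qed

text \<open>The product of \<open>A\<close> with the augmentation ideal of the group ring generated by \<open>x\<close> and \<open>y\<close>.\<close>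

definition J where "J x y = {delta x a \<otimes> delta y b | a b. a \<in> A \<and> b \<in> A}"

lemma J_A: "\<lbrakk>x \<in> carrier G; y \<in> carrier G; j \<in> J x y\<rbrakk> \<Longrightarrow> j \<in> A"
  by (auto simp: J_def)

lemma J_mult:
  assumes "x \<in> carrier G" "y \<in> carrier G" "j \<in> J x y" "k \<in> J x y"
  shows "j \<otimes> k \<in> J x y"
proof -
  obtain a b c d where ab: "a \<in> A" "b \<in> A" "c \<in> A" "d \<in> A"
    and "j = delta x a \<otimes> delta y b" "k = delta x c \<otimes> delta y d"
    using assms by (auto simp: J_def)
  then have "j \<otimes> k = delta x (a \<otimes> c) \<otimes> delta y (b \<otimes> d)"
    using assms by (simp add: delta_mult A_ac)
  then show ?thesis
    using ab unfolding J_def by (intro CollectI exI[of _ "a \<otimes> c"] exI[of _ "b \<otimes> d"]) auto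
qed

lemma J_one: "\<lbrakk>x \<in> carrier G; y \<in> carrier G\<rbrakk> \<Longrightarrow> \<one> \<in> J x y"
  by (auto simp: J_def intro!: exI[of _ \<one>])

lemma J_pow: "\<lbrakk>x \<in> carrier G; y \<in> carrier G; j \<in> J x y\<rbrakk> \<Longrightarrow> j [^] (n::nat) \<in> J x y"
  by (induction n) (auto intro: J_one J_mult)

lemma delta_J_left: "\<lbrakk>x \<in> carrier G; y \<in> carrier G; a \<in> A\<rbrakk> \<Longrightarrow> delta x a \<in> J x y"
  unfolding J_def by (rule CollectI, rule exI[of _ a], rule exI[of _ \<one>]) simp

lemma delta_J_right: "\<lbrakk>x \<in> carrier G; y \<in> carrier G; a \<in> A\<rbrakk> \<Longrightarrow> delta y a \<in> J x y"
  unfolding J_def by (rule CollectI, rule exI[of _ \<one>], rule exI[of _ a]) simp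

text \<open>This rests on uv - 1 = (v - 1)(u - 1) + (u - 1) + (v - 1). It leads to the fact that
  monomials in x and y act trivially modulo \<open>J\<close>.\<close>

lemma delta_mult_in_J:
  assumes x: "x \<in> carrier G" "y \<in> carrier G" and u: "u \<in> carrier G" "v \<in> carrier G"
    and J: "\<And>a. a \<in> A \<Longrightarrow> delta u a \<in> J x y" "\<And>a. a \<in> A \<Longrightarrow> delta v a \<in> J x y" and a: "a \<in> A"
  shows "delta (u \<otimes> v) a \<in> J x y"
proof -
  have "delta (u \<otimes> v) a = delta v (delta u a) \<otimes> delta u a \<otimes> delta v a"
    using u a by (simp add: delta_group_mult conjugate_eq_delta)
  then show ?thesis
    using x u a by (auto intro!: J_mult J)
qed

lemma delta_pow_in_J:
  assumes x: "x \<in> carrier G" "y \<in> carrier G" and u: "u \<in> carrier G"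
    and J: "\<And>a. a \<in> A \<Longrightarrow> delta u a \<in> J x y" and a: "a \<in> A"
  shows "delta (u [^] (n::nat)) a \<in> J x y"
  using a
proof (induction n arbitrary: a)
  case 0
  then show ?case using x by (simp add: delta_def J_one)
next
  case (Suc n)
  then show ?case using assms by (auto intro!: delta_mult_in_J)
qed

lemma delta_monomial_in_J:
  "\<lbrakk>x \<in> carrier G; y \<in> carrier G; a \<in> A\<rbrakk> \<Longrightarrow> delta (x [^] (p::nat) \<otimes> y [^] (q::nat)) a \<in> J x y"
  by (auto intro!: delta_mult_in_J delta_pow_in_J delta_J_left delta_J_right)

lemma J_pow_subset:
  assumes x: "x \<in> carrier G" "y \<in> carrier G"
  shows "J (x [^] (m::nat)) (y [^] (n::nat)) \<subseteq> J x y"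
proof
  fix j assume "j \<in> J (x [^] m) (y [^] n)"
  then obtain a b where ab: "a \<in> A" "b \<in> A" "j = delta (x [^] m) a \<otimes> delta (y [^] n) b"
    unfolding J_def by blast
  show "j \<in> J x y"
    unfolding ab(3) using x ab(1,2)
    by (intro J_mult delta_pow_in_J delta_J_left delta_J_right) auto
qed

section \<open>Commutators modulo J\<close>

lemma commutator_mult_left:
  assumes "a \<in> carrier G" "b \<in> carrier G" "c \<in> carrier G"
  shows "commutator G (a \<otimes> b) c = conjugate G (commutator G a c) b \<otimes> commutator G b c"
  using assms by (simp add: commutator_def conjugate_def m_assoc inv_mult_group inv_mult_cancel)

lemma commutator_mult_right:
  assumes "a \<in> carrier G" "b \<in> carrier G" "c \<in> carrier G"
  shows "commutator G c (a \<otimes> b) = commutator G c b \<otimes> conjugate G (commutator G c a) b"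
  using assms by (simp add: commutator_def conjugate_def m_assoc inv_mult_group inv_mult_cancel)

text \<open>Conjugation by x is trivial modulo \<open>J\<close>, so the conjugate in
  \<open>commutator_mult_left\<close> disappears there and the commutator becomes additive in its
  first argument.\<close>

lemma commutator_pow_left:
  assumes x: "x \<in> carrier G" "y \<in> carrier G"
  shows "\<exists>j\<in>J x y. commutator G (x [^] (n::nat)) y = commutator G x y [^] n \<otimes> j"
proof (induction n)
  case 0
  show ?case using x by (intro bexI[of _ \<one>]) (simp_all add: J_one commutator_def)
next
  case (Suc n)
  from Suc.IH obtain j where j: "j \<in> J x y"
    "commutator G (x [^] n) y = commutator G x y [^] n \<otimes> j" by (rule bexE)
  have jA: "j \<in> A" by (rule J_A[OF x j(1)])
  let ?m = "commutator G x y [^] n \<otimes> j"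
  have "commutator G (x [^] Suc n) y = delta x ?m \<otimes> ?m \<otimes> commutator G x y"
    using x j jA by (simp add: commutator_mult_left conjugate_eq_delta)
  also have "\<dots> = commutator G x y [^] Suc n \<otimes> (delta x ?m \<otimes> j)"
    using x jA by (simp add: A_ac)
  finally show ?case
    using x j jA by (intro bexI[of _ "delta x ?m \<otimes> j"]) (auto intro!: J_mult delta_J_left)
qed

lemma commutator_pow_right:
  assumes x: "x \<in> carrier G" "y \<in> carrier G"
  shows "\<exists>j\<in>J x y. commutator G x (y [^] (n::nat)) = commutator G x y [^] n \<otimes> j"
proof (induction n)
  case 0
  show ?case using x by (intro bexI[of _ \<one>]) (simp_all add: J_one commutator_def)
next
  case (Suc n)
  from Suc.IH obtain j where j: "j \<in> J x y"
    "commutator G x (y [^] n) = commutator G x y [^] n \<otimes> j" by (rule bexE)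
  have jA: "j \<in> A" by (rule J_A[OF x j(1)])
  let ?m = "commutator G x y [^] n \<otimes> j"
  have "commutator G x (y [^] Suc n) = commutator G x y \<otimes> (delta y ?m \<otimes> ?m)"
    using x j jA by (simp add: commutator_mult_right conjugate_eq_delta)
  also have "\<dots> = commutator G x y [^] Suc n \<otimes> (delta y ?m \<otimes> j)"
    using x jA by (simp add: A_ac)
  finally show ?case
    using x j jA by (intro bexI[of _ "delta y ?m \<otimes> j"]) (auto intro!: J_mult delta_J_right)
qed

lemma commutator_pow_pow:
  assumes x: "x \<in> carrier G" "y \<in> carrier G"
  shows "\<exists>j\<in>J x y. commutator G (x [^] (m::nat)) (y [^] (n::nat))
    = commutator G x y [^] (m * n) \<otimes> j"
proof -
  obtain j where j: "j \<in> J x y" "commutator G (x [^] m) y = commutator G x y [^] m \<otimes> j"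
    using commutator_pow_left[OF x] by blast
  obtain k where k: "k \<in> J (x [^] m) y"
    "commutator G (x [^] m) (y [^] n) = commutator G (x [^] m) y [^] n \<otimes> k"
    using commutator_pow_right[of "x [^] m" y] x by auto
  have kJ: "k \<in> J x y"
    using k(1) J_pow_subset[OF x, of m 1] x by auto
  have "commutator G (x [^] m) (y [^] n) = commutator G x y [^] (m * n) \<otimes> (j [^] n \<otimes> k)"
    using x j k kJ J_A[OF x] by (simp add: A_pow_mult nat_pow_pow m_assoc)
  then show ?thesis
    using x j kJ by (auto intro!: J_mult J_pow)
qed

text \<open>Other representatives of the cosets of x and y modulo \<open>A\<close> shift the
  commutator by an element of \<open>J\<close>; as \<open>a\<close> and \<open>b\<close> run over
  \<open>A\<close>, every element of \<open>J\<close> occurs as a shift.\<close>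

lemma commutator_mult_A:
  assumes x: "x \<in> carrier G" "y \<in> carrier G" and a: "a \<in> A" "b \<in> A"
  shows "commutator G (x \<otimes> a) (y \<otimes> b) = commutator G x y \<otimes> (delta x (inv b) \<otimes> delta y a)"
proof -
  \<comment> \<open>The word is regrouped so that each factor lies in \<open>A\<close>;
    commutativity of \<open>A\<close> then does the rest.\<close>
  have "commutator G (x \<otimes> a) (y \<otimes> b)
    = inv a \<otimes> conjugate G (inv b) x \<otimes> (commutator G x y \<otimes> conjugate G a y) \<otimes> b"
    using assms by (simp add: commutator_def conjugate_def inv_mult_group m_assoc inv_mult_cancel)
  also have "\<dots> = commutator G x y \<otimes> (delta x (inv b) \<otimes> delta y a)"
    using assms by (simp add: delta_def A_ac)
  finally show ?thesis .
qed

end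

section \<open>Exponents modulo the group order, and maps with equal fibres\<close>

lemma (in group) nat_pow_cong:
  assumes "[m = n] (mod order G)" "x \<in> carrier G"
  shows "x [^] (m::nat) = x [^] n"
proof -
  have "x [^] k = x [^] (k mod order G)" for k :: nat
  proof -
    have "x [^] k = x [^] (order G * (k div order G) + k mod order G)"
      by simp
    also have "\<dots> = (x [^] order G) [^] (k div order G) \<otimes> x [^] (k mod order G)"
      using assms(2) by (simp only: nat_pow_mult[symmetric] nat_pow_pow)
    finally show ?thesis
      using assms(2) by (simp add: pow_order_eq_1)
  qed
  then show ?thesis
    using assms(1) by (metis cong_def)
qed

lemma (in group) nat_pow_pow_cancel:
  assumes "[m * n = 1] (mod order G)" "x \<in> carrier G"
  shows "(x [^] m) [^] (n::nat) = x"
  using nat_pow_cong[OF assms] assms(2) by (simp add: nat_pow_pow)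

text \<open>The bound also holds with \<open>s\<close> and \<open>s'\<close> exchanged, so all
  fibres over the image have the same size.\<close>

lemma card_uniform_fibre:
  assumes "finite S" and le: "\<And>s s'. \<lbrakk>s \<in> S; s' \<in> S\<rbrakk>
      \<Longrightarrow> card {r \<in> S. f r = f s} \<le> card {r \<in> S. f r = f s'}"
    and "g \<in> f ` S"
  shows "card {r \<in> S. f r = g} = card S div card (f ` S)"
proof -
  obtain s where s: "s \<in> S" "g = f s" using assms by blast
  have "card S = (\<Sum>h\<in>f ` S. card {r \<in> S. f r = h})"
    using sum.image_gen[OF assms(1), of "\<lambda>_. 1::nat" f] by simp
  also have "\<dots> = (\<Sum>h\<in>f ` S. card {r \<in> S. f r = g})"
    using le s by (intro sum.cong refl) (auto intro!: antisym)
  finally have "card S = card {r \<in> S. f r = g} * card (f ` S)" by simp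
  moreover have "card (f ` S) \<noteq> 0"
    using assms by auto
  ultimately show ?thesis by simp
qed

section \<open>Value cosets and the equality of the counts\<close>

context metabelian
begin

text \<open>For q = 7, the exponents p = 1 and p = 2 give the word maps of \<open>elem_g1\<close>
  and \<open>elem_g2\<close>; see \<open>hom_elem\<close>.\<close>

definition double_delta where
  "double_delta p q x y = delta x (delta (x [^] (p::nat) \<otimes> y [^] (q::nat)) (commutator G x y))"

text \<open>When v is the monomial x^p y^q, this is the set of values of
  \<open>double_delta p q\<close> on the pair of cosets xA and yA; see
  \<open>image_double_delta\<close>.\<close>

definition value_coset where
  "value_coset x y v = (\<lambda>j. delta x (delta v (commutator G x y \<otimes> j))) ` J x y"

text \<open>Modulo \<open>J\<close> the commutator of x^i and y^t is it c = c. Up to terms with a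
  further factor x - 1 or v - 1, the operator (x^i - 1)(v^t - 1) is it (x - 1)(v - 1). Those terms
  are absorbed by \<open>J\<close>, and it acts as 1 because the order of the group annihilates
  \<open>A\<close>.\<close>

lemma value_coset_pow_subset:
  assumes x: "x \<in> carrier G" "y \<in> carrier G" and v: "v \<in> carrier G"
    and vJ: "\<And>a. a \<in> A \<Longrightarrow> delta v a \<in> J x y" and v': "same_action v' (v [^] t)"
    and it: "[i * t = 1] (mod order G)"
  shows "value_coset (x [^] i) (y [^] t) v' \<subseteq> value_coset x y v"
proof
  fix g assume "g \<in> value_coset (x [^] i) (y [^] t) v'"
  then obtain z where z: "z \<in> J (x [^] i) (y [^] t)"
    and g: "g = delta (x [^] i) (delta v' (commutator G (x [^] i) (y [^] t) \<otimes> z))"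
    unfolding value_coset_def by blast
  define c where "c = commutator G x y"
  have c: "c \<in> A" using x by (simp add: c_def)
  have zJ: "z \<in> J x y" using z J_pow_subset[OF x] by blast
  obtain k where k: "k \<in> J x y" "commutator G (x [^] i) (y [^] t) = c [^] (i * t) \<otimes> k"
    using commutator_pow_pow[OF x] unfolding c_def by blast
  define j where "j = k \<otimes> z"
  have j: "j \<in> J x y" using x zJ k(1) by (simp add: j_def J_mult)
  have jA: "j \<in> A" by (rule J_A[OF x j])
  have kA: "k \<in> A" by (rule J_A[OF x k(1)])
  have zA: "z \<in> A" by (rule J_A[OF x zJ])
  have c_it: "c [^] (i * t) = c"
    using nat_pow_cong[OF it, of c] c by simp
  have cj: "commutator G (x [^] i) (y [^] t) \<otimes> z = c \<otimes> j"
    unfolding k(2) c_it j_def using c kA zA by (simp add: m_assoc)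
  obtain b where b: "b \<in> A" "delta (v [^] t) (c \<otimes> j) = delta v ((c \<otimes> j) [^] t \<otimes> delta v b)"
    using delta_group_pow[OF v, of "c \<otimes> j"] c jA by auto
  define m where "m = (c \<otimes> j) [^] t \<otimes> delta v b"
  have m: "m \<in> A" using c jA b v by (simp add: m_def)
  obtain d where d: "d \<in> A" "delta (x [^] i) m = delta x (m [^] i \<otimes> delta x d)"
    using delta_group_pow[OF x(1) m] by blast
  have "g = delta (x [^] i) (delta v m)"
    unfolding g cj using delta_same_action[OF v'] b c jA by (simp add: m_def)
  \<comment> \<open>The operators commute, so v - 1 can be moved outwards while x^i - 1 is expanded
    on \<open>m\<close>, and back again afterwards.\<close>
  also have "\<dots> = delta x (delta v (m [^] i \<otimes> delta x d))"
    using x v m d by (simp add: delta_commute[of "x [^] i"] delta_commute[of x])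
  also have "m [^] i \<otimes> delta x d = c \<otimes> (j [^] (t * i) \<otimes> delta v b [^] i \<otimes> delta x d)"
  proof -
    have "m [^] i = c [^] (i * t) \<otimes> (j [^] (t * i) \<otimes> delta v b [^] i)"
      using c jA b v by (simp add: m_def A_pow_mult nat_pow_pow m_assoc mult.commute)
    then show ?thesis
      unfolding c_it using c jA b v d x by (simp add: m_assoc)
  qed
  finally have "g = delta x (delta v (c \<otimes> (j [^] (t * i) \<otimes> delta v b [^] i \<otimes> delta x d)))" .
  moreover have "j [^] (t * i) \<otimes> delta v b [^] i \<otimes> delta x d \<in> J x y"
    using x j b d by (intro J_mult J_pow vJ delta_J_left)
  ultimately show "g \<in> value_coset x y v"
    unfolding value_coset_def c_def by (rule image_eqI)
qed

text \<open>The congruence \<open>p\<close> gives (x^i)^p = (x^p')^t, so the new monomial acts on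
  \<open>A\<close> as the t-th power of the old one.\<close>

lemma value_coset_pow:
  assumes x: "x \<in> carrier G" "y \<in> carrier G"
    and it: "[i * t = 1] (mod order G)" and p: "[i * p = t * p'] (mod order G)"
  shows "value_coset (x [^] i) (y [^] t) ((x [^] i) [^] (p::nat) \<otimes> (y [^] t) [^] (q::nat))
    = value_coset x y (x [^] p' \<otimes> y [^] q)" (is "value_coset ?x ?y ?v' = value_coset x y ?v")
proof
  have ti: "[t * i = 1] (mod order G)" using it by (simp add: mult.commute)
  have "?v' = x [^] (t * p') \<otimes> y [^] (t * q)"
    using x nat_pow_cong[OF p] by (simp add: nat_pow_pow)
  also have "\<dots> = (x [^] p') [^] t \<otimes> (y [^] q) [^] t"
    using x by (simp add: nat_pow_pow mult.commute)
  finally have s: "same_action ?v' (?v [^] t)"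
    using x same_action_sym[OF same_action_pow_mult] by simp
  show "value_coset ?x ?y ?v' \<subseteq> value_coset x y ?v"
    using x it s by (intro value_coset_pow_subset delta_monomial_in_J) auto
  \<comment> \<open>The substitution is undone by raising x^i to t and y^t to i. So the reverse
    inclusion is the same lemma with \<open>i\<close> and \<open>t\<close> exchanged.\<close>
  have "(?v [^] t) [^] i = ?v" "?x [^] t = x" "?y [^] i = y"
    using x nat_pow_pow_cancel[OF it] nat_pow_pow_cancel[OF ti] by auto
  moreover from this have "same_action ?v (?v' [^] i)"
    using same_action_pow[OF s, of i] by (simp add: same_action_sym)
  ultimately show "value_coset x y ?v \<subseteq> value_coset ?x ?y ?v'"
    using x value_coset_pow_subset[OF _ _ _ _ _ ti, of ?x ?y ?v' ?v] delta_monomial_in_J[of ?x ?y]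
    by simp
qed

lemma double_delta_mult_A:
  assumes x: "x \<in> carrier G" "y \<in> carrier G" and a: "a \<in> A" "b \<in> A"
  shows "double_delta p q (x \<otimes> a) (y \<otimes> b)
    = delta x (delta (x [^] p \<otimes> y [^] q) (commutator G x y \<otimes> (delta x (inv b) \<otimes> delta y a)))"
proof -
  have s: "same_action (x \<otimes> a) x" "same_action (y \<otimes> b) y"
    using assms by (auto intro: same_action_mult_A)
  then have s': "same_action ((x \<otimes> a) [^] p \<otimes> (y \<otimes> b) [^] q) (x [^] p \<otimes> y [^] q)"
    by (intro same_action_mult same_action_pow)
  show ?thesis
    unfolding double_delta_def commutator_mult_A[OF assms]
    using assms by (simp add: delta_same_action[OF s(1)] delta_same_action[OF s'])
qed

lemma image_double_delta:
  assumes x: "x \<in> carrier G" "y \<in> carrier G"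
  shows "(\<lambda>(a, b). double_delta p q (x \<otimes> a) (y \<otimes> b)) ` (A \<times> A) = value_coset x y (x [^] p \<otimes> y [^] q)"
    (is "?f ` _ = value_coset x y ?v")
proof -
  have "value_coset x y ?v \<subseteq> ?f ` (A \<times> A)"
  proof
    fix g assume "g \<in> value_coset x y ?v"
    then obtain a b where ab: "a \<in> A" "b \<in> A"
      "g = delta x (delta ?v (commutator G x y \<otimes> (delta x a \<otimes> delta y b)))"
      unfolding value_coset_def J_def by blast
    \<comment> \<open>In \<open>commutator_mult_A\<close> the shift of y enters inverted under
      \<open>delta x\<close> and the shift of x under \<open>delta y\<close>; hence the pair is
      swapped and one entry inverted.\<close>
    then show "g \<in> ?f ` (A \<times> A)"
      using x double_delta_mult_A[of x y b "inv a" p q] by (intro image_eqI[of _ _ "(b, inv a)"]) auto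
  qed
  moreover have "?f ` (A \<times> A) \<subseteq> value_coset x y ?v"
    using x by (auto simp: double_delta_mult_A value_coset_def J_def intro!: imageI) (metis A_inv)
  ultimately show ?thesis by blast
qed

text \<open>On a pair of cosets of \<open>A\<close> the map \<open>f\<close> is affine with linear
  part \<open>L\<close>. The translation taking (a, b) to (a', b') therefore embeds one fibre into
  the other.\<close>

lemma card_double_delta_fibre_le:
  fixes p q :: nat
  assumes fin: "finite (carrier G)" and x: "x \<in> carrier G" "y \<in> carrier G"
    and ab: "a \<in> A" "b \<in> A" "a' \<in> A" "b' \<in> A"
  defines "f \<equiv> \<lambda>(a, b). double_delta p q (x \<otimes> a) (y \<otimes> b)"
  shows "card {r \<in> A \<times> A. f r = f (a, b)} \<le> card {r \<in> A \<times> A. f r = f (a', b')}"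
proof (rule card_inj_on_le)
  define h where "h = (\<lambda>(c, d). (c \<otimes> (inv a \<otimes> a'), d \<otimes> (inv b \<otimes> b')))"
  define L where "L = (\<lambda>a b. delta x (delta (x [^] p \<otimes> y [^] q) (delta x (inv b) \<otimes> delta y a)))"
  have L: "f (c \<otimes> c', d \<otimes> d') = f (c, d) \<otimes> L c' d'"
    if "c \<in> A" "d \<in> A" "c' \<in> A" "d' \<in> A" for c d c' d'
    using x that by (simp add: f_def L_def double_delta_mult_A inv_mult_group delta_mult A_ac)
  show "inj_on h {r \<in> A \<times> A. f r = f (a, b)}"
    using ab by (auto simp: inj_on_def h_def)
  have "f (c \<otimes> (inv a \<otimes> a'), d \<otimes> (inv b \<otimes> b')) = f (a', b')"
    if "c \<in> A" "d \<in> A" "f (c, d) = f (a, b)" for c d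
  proof -
    have "f (c \<otimes> (inv a \<otimes> a'), d \<otimes> (inv b \<otimes> b'))
      = f (a \<otimes> (inv a \<otimes> a'), b \<otimes> (inv b \<otimes> b'))"
      using that ab by (simp add: L)
    then show ?thesis using ab by (simp add: inv_mult_cancel)
  qed
  then show "h ` {r \<in> A \<times> A. f r = f (a, b)} \<subseteq> {r \<in> A \<times> A. f r = f (a', b')}"
    using ab by (auto simp: h_def)
  show "finite {r \<in> A \<times> A. f r = f (a', b')}"
    using finite_subset[OF subgroup.subset[OF subgroup_A] fin] by simp
qed

text \<open>The count on a pair of cosets depends only on the set of values there, so equality of
  value cosets suffices for equality of counts.\<close>

lemma card_double_delta_fibre:
  assumes fin: "finite (carrier G)" and x: "x \<in> carrier G" "y \<in> carrier G"
  shows "card {r \<in> A \<times> A. double_delta p q (x \<otimes> fst r) (y \<otimes> snd r) = g}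
    = (let D = value_coset x y (x [^] p \<otimes> y [^] q) in if g \<in> D then card (A \<times> A) div card D else 0)"
proof -
  let ?f = "\<lambda>(a, b). double_delta p q (x \<otimes> a) (y \<otimes> b)"
  have finA: "finite (A \<times> A)"
    using finite_subset[OF subgroup.subset[OF subgroup_A] fin] by simp
  have "card {r \<in> A \<times> A. ?f r = g}
    = (if g \<in> ?f ` (A \<times> A) then card (A \<times> A) div card (?f ` (A \<times> A)) else 0)"
  proof (cases "g \<in> ?f ` (A \<times> A)")
    case True
    have "card {r \<in> A \<times> A. ?f r = ?f s} \<le> card {r \<in> A \<times> A. ?f r = ?f s'}"
      if "s \<in> A \<times> A" "s' \<in> A \<times> A" for s s'
      using card_double_delta_fibre_le[OF fin x, of "fst s" "snd s" "fst s'" "snd s'" p q] that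
      by (simp add: mem_Times_iff)
    then show ?thesis
      using card_uniform_fibre[OF finA _ True] True by simp
  next
    case False
    then have empty: "{r \<in> A \<times> A. ?f r = g} = {}" by blast
    show ?thesis unfolding empty using False by simp
  qed
  then show ?thesis
    unfolding image_double_delta[OF x] Let_def by (simp add: case_prod_unfold)
qed

lemma bij_betw_mult_right:
  assumes "a \<in> carrier G" shows "bij_betw (\<lambda>x. x \<otimes> a) (carrier G) (carrier G)"
  by (rule bij_betw_byWitness[where f' = "\<lambda>x. x \<otimes> inv a"]) (use assms in \<open>auto simp: m_assoc\<close>)

text \<open>Double counting: each shift by an element of \<open>A \<times> A\<close> permutes all
  pairs, so every shift contributes the same number of solutions.\<close>

lemma card_average:
  assumes fin: "finite (carrier G)"
  shows "card (A \<times> A) * card {z \<in> carrier G \<times> carrier G. P (fst z) (snd z)}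
    = (\<Sum>z \<in> carrier G \<times> carrier G. card {r \<in> A \<times> A. P (fst z \<otimes> fst r) (snd z \<otimes> snd r)})"
proof -
  let ?S = "carrier G \<times> carrier G"
  have finA: "finite (A \<times> A)"
    using finite_subset[OF subgroup.subset[OF subgroup_A] fin] by simp
  have card_eq: "card {z \<in> S. Q z} = (\<Sum>z\<in>S. of_bool (Q z))" if "finite S" for S :: "'z set" and Q
    using that by (simp add: sum_of_bool_eq Collect_conj_eq)
  have shift: "(\<Sum>(x, y)\<in>?S. of_bool (P (x \<otimes> a) (y \<otimes> b)))
      = (\<Sum>(x, y)\<in>?S. of_bool (P x y) :: nat)" if "a \<in> A" "b \<in> A" for a b
    using sum.reindex_bij_betw[OF bij_betw_map_prod[OF bij_betw_mult_right bij_betw_mult_right],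
        of a b "\<lambda>(x, y). of_bool (P x y) :: nat"] that
    by (simp add: case_prod_unfold)
  have "(\<Sum>z\<in>?S. card {r \<in> A \<times> A. P (fst z \<otimes> fst r) (snd z \<otimes> snd r)})
    = (\<Sum>z\<in>?S. \<Sum>r\<in>A \<times> A. of_bool (P (fst z \<otimes> fst r) (snd z \<otimes> snd r)))"
    by (simp add: card_eq[OF finA])
  also have "\<dots> = (\<Sum>r\<in>A \<times> A. \<Sum>z\<in>?S. of_bool (P (fst z \<otimes> fst r) (snd z \<otimes> snd r)))"
    by (rule sum.swap)
  also have "\<dots> = (\<Sum>r\<in>A \<times> A. \<Sum>z\<in>?S. of_bool (P (fst z) (snd z)))"
    by (rule sum.cong[OF refl]) (use shift in \<open>simp add: case_prod_unfold mem_Times_iff\<close>)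
  also have "\<dots> = card (A \<times> A) * card {z \<in> ?S. P (fst z) (snd z)}"
    using fin by (simp add: card_eq)
  finally show ?thesis by simp
qed

lemma bij_betw_nat_pow:
  assumes it: "[i * t = 1] (mod order G)"
  shows "bij_betw (\<lambda>x. x [^] (i::nat)) (carrier G) (carrier G)"
proof (rule bij_betw_byWitness[where f' = "\<lambda>x. x [^] t"])
  have "[t * i = 1] (mod order G)" using it by (simp add: mult.commute)
  then show "\<forall>x\<in>carrier G. (x [^] t) [^] i = x"
    using nat_pow_pow_cancel by blast
  show "\<forall>x\<in>carrier G. (x [^] i) [^] t = x"
    using nat_pow_pow_cancel[OF it] by blast
qed auto

text \<open>Since \<open>i\<close> and \<open>t\<close> are units modulo the order, (x, y) -> (x^i,
  y^t) permutes the pairs. Solutions need not correspond one by one, but the averages over pairs of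
  cosets agree.\<close>

lemma card_double_delta_pow:
  assumes fin: "finite (carrier G)" and it: "[i * t = 1] (mod order G)"
    and p: "[i * p = t * p'] (mod order G)"
  shows "card {z \<in> carrier G \<times> carrier G. double_delta p q (fst z) (snd z) = g}
    = card {z \<in> carrier G \<times> carrier G. double_delta p' q (fst z) (snd z) = g}"
proof -
  let ?S = "carrier G \<times> carrier G"
  let ?F = "\<lambda>p x y. card {r \<in> A \<times> A. double_delta p q (x \<otimes> fst r) (y \<otimes> snd r) = g}"
  have ti: "[t * i = 1] (mod order G)" using it by (simp add: mult.commute)
  have "card (A \<times> A) * card {z \<in> ?S. double_delta p q (fst z) (snd z) = g} = (\<Sum>z\<in>?S. ?F p (fst z) (snd z))"
    by (rule card_average[OF fin])
  also have "\<dots> = (\<Sum>z\<in>?S. ?F p (fst z [^] i) (snd z [^] t))"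
    using sum.reindex_bij_betw[OF bij_betw_map_prod[OF bij_betw_nat_pow[OF it] bij_betw_nat_pow[OF ti]],
        of "\<lambda>z. ?F p (fst z) (snd z)"]
    by (simp add: case_prod_unfold)
  also have "\<dots> = (\<Sum>z\<in>?S. ?F p' (fst z) (snd z))"
    by (rule sum.cong[OF refl]) (auto simp: card_double_delta_fibre[OF fin] value_coset_pow[OF _ _ it p] simp del: mem_Collect_eq)
  also have "\<dots> = card (A \<times> A) * card {z \<in> ?S. double_delta p' q (fst z) (snd z) = g}"
    by (rule card_average[OF fin, symmetric])
  \<comment> \<open>The factor \<open>card (A \<times> A)\<close> cancels: \<open>A\<close> is
    finite and contains the identity.\<close>
  finally show ?thesis
    using finite_subset[OF subgroup.subset[OF subgroup_A] fin] A_one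
    by (auto simp del: A_one)
qed

text \<open>Powers of x commute with x, so y -> x^k y fixes [x, y]; on \<open>A\<close> the factor
  (x^k y)^q acts as x^(kq) y^q.\<close>

lemma double_delta_shear:
  assumes x: "x \<in> carrier G" "y \<in> carrier G"
  shows "double_delta p q x (x [^] (k::nat) \<otimes> y) = double_delta (p + k * q) q x y"
proof -
  have "commutator G x (x [^] k) = \<one>"
    using x nat_pow_Suc2[of x k, symmetric] by (simp add: commutator_def m_assoc inv_mult_cancel)
  then have c: "commutator G x (x [^] k \<otimes> y) = commutator G x y"
    using x by (simp add: commutator_mult_right)
  have "same_action (x [^] p \<otimes> (x [^] k \<otimes> y) [^] q) (x [^] p \<otimes> ((x [^] k) [^] q \<otimes> y [^] q))"
    using x by (intro same_action_mult same_action_pow_mult same_action_refl) auto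
  also have "\<dots> = x [^] (p + k * q) \<otimes> y [^] q"
    using x by (simp add: nat_pow_pow nat_pow_mult flip: m_assoc)
  finally show ?thesis
    unfolding double_delta_def c using x by (simp add: delta_same_action)
qed

lemma card_double_delta_shear:
  "card {z \<in> carrier G \<times> carrier G. double_delta p q (fst z) (snd z) = g}
    = card {z \<in> carrier G \<times> carrier G. double_delta (p + k * q) q (fst z) (snd z) = g}"
proof (rule bij_betw_same_card[symmetric],
    rule bij_betw_byWitness[where f' = "\<lambda>(x, y). (x, inv (x [^] k) \<otimes> y)"
      and f = "\<lambda>(x, y). (x, x [^] k \<otimes> y)"])
  show "(\<lambda>(x, y). (x, inv (x [^] k) \<otimes> y)) ` {z \<in> carrier G \<times> carrier G. double_delta p q (fst z) (snd z) = g}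
    \<subseteq> {z \<in> carrier G \<times> carrier G. double_delta (p + k * q) q (fst z) (snd z) = g}"
    by (auto simp flip: double_delta_shear simp: inv_mult_cancel)
qed (auto simp: inv_mult_cancel double_delta_shear)

lemma card_double_delta_1_2:
  assumes fin: "finite (carrier G)"
  shows "card {z \<in> carrier G \<times> carrier G. double_delta 1 7 (fst z) (snd z) = g}
    = card {z \<in> carrier G \<times> carrier G. double_delta 2 7 (fst z) (snd z) = g}"
proof -
  define N where "N = order G"
  have "N \<noteq> 0" using fin by (auto simp: N_def order_def)
  \<comment> \<open>Splitting off the 7-part leaves \<open>m\<close> coprime to 7, so that residues
    modulo 7 and \<open>m\<close> can be prescribed independently even if 7 divides the
    order.\<close>
  then obtain m where m: "N = 7 ^ multiplicity 7 N * m" "\<not> 7 dvd m"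
    using multiplicity_decompose'[of N 7] by auto
  have "Factorial_Ring.prime (7::nat)" by simp
  then have co: "coprime 7 m" using m(2) by (rule prime_imp_coprime)
  \<comment> \<open>The residue 2 gives 2 t^2 = 8 = 1 modulo 7. The residue 1 only serves to make
    \<open>t\<close> coprime to \<open>m\<close>, and thus invertible modulo
    \<open>N\<close>.\<close>
  obtain t where t: "[t = 2] (mod 7)" "[t = 1] (mod m)"
    using binary_chinese_remainder_nat[OF co] by blast
  have "coprime (2::nat) 7" by (simp add: coprime_iff_gcd_eq_1 gcd_non_0_nat)
  then have "coprime t 7" by (rule cong_imp_coprime[OF cong_sym[OF t(1)]])
  moreover have "coprime t m"
    using cong_imp_coprime[OF cong_sym[OF t(2)]] by simp
  ultimately have "coprime t N"
    by (subst m(1)) simp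
  then obtain i where "[t * i = 1] (mod N)"
    using cong_solve_coprime_nat by auto
  then have it: "[i * t = 1] (mod N)" by (simp add: mult.commute)
  have "[2 * t * t = 2 * 2 * 2] (mod 7)"
    using t(1) by (intro cong_mult cong_refl)
  then have "2 * t * t mod 7 = 1" by (simp add: cong_def)
  then obtain k where k: "2 * t * t = 1 + k * 7"
    by (metis mod_mult_div_eq mult.commute)
  have "[2 * t * (i * t) = 2 * t * 1] (mod N)"
    by (rule cong_mult[OF cong_refl it])
  \<comment> \<open>Here 1 + 7 k = 2 t^2, and i 2 t^2 = 2 t modulo \<open>N\<close> because
    \<open>i\<close> inverts \<open>t\<close>. The shear by \<open>k\<close> then relates 1 + 7 k to
    1.\<close>
  then have p: "[i * (1 + k * 7) = t * 2] (mod N)"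
    unfolding k[symmetric] by (simp add: mult_ac)
  show ?thesis
    using card_double_delta_shear[of 1 7 g k] card_double_delta_pow[OF fin it[unfolded N_def] p[unfolded N_def], of 7 g] by simp
qed

end

section \<open>Evaluation of the two elements\<close>

lemma (in group_hom) hom_conjugate:
  "\<lbrakk>a \<in> carrier G; z \<in> carrier G\<rbrakk> \<Longrightarrow> h (conjugate G a z) = conjugate H (h a) (h z)"
  by (simp add: conjugate_def)

lemma (in group_hom) hom_commutator:
  "\<lbrakk>a \<in> carrier G; b \<in> carrier G\<rbrakk> \<Longrightarrow> h (commutator G a b) = commutator H (h a) (h b)"
  by (simp add: commutator_def)

lemma (in group) commutator_eq_one_iff:
  assumes "a \<in> carrier G" "b \<in> carrier G"
  shows "commutator G a b = \<one> \<longleftrightarrow> a \<otimes> b = b \<otimes> a"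
proof -
  have "a \<otimes> b = b \<otimes> a \<otimes> commutator G a b"
    using assms by (simp add: commutator_def m_assoc inv_mult_cancel)
  then show ?thesis
    using assms by simp
qed

lemma elem_closed:
  "elem_g1 \<in> carrier (free_metabelian 2)" "elem_g2 \<in> carrier (free_metabelian 2)"
proof -
  interpret M: group "free_metabelian 2" by (rule group_free_metabelian)
  show "elem_g1 \<in> carrier (free_metabelian 2)" "elem_g2 \<in> carrier (free_metabelian 2)"
    by (simp_all add: elem_g1_def elem_g2_def Let_def basis_elem_closed)
qed

context metabelian
begin

lemma metabelian_group: "metabelian_group G"
  by (simp add: metabelian_group_def second_derived)

lemma hom_elem:
  assumes h: "h \<in> hom (free_metabelian 2) G"
  defines "x \<equiv> h (basis_elem 2 0)" and "y \<equiv> h (basis_elem 2 1)"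
  shows "h elem_g1 = double_delta 1 7 x y" "h elem_g2 = double_delta 2 7 x y"
proof -
  interpret h: group_hom "free_metabelian 2" G h
    by (simp add: group_hom_def group_hom_axioms_def h group_free_metabelian group_axioms)
  have xy: "x \<in> carrier G" "y \<in> carrier G"
    by (simp_all add: x_def y_def basis_elem_closed)
  \<comment> \<open>In \<open>delta_delta\<close> the product is x (x^p y^7), while the elements
    contain x^(p+1) y^7.\<close>
  have "x \<otimes> (x [^] n \<otimes> y [^] (7::nat)) = x [^] Suc n \<otimes> y [^] (7::nat)" for n :: nat
    using xy by (simp only: nat_pow_Suc2 m_assoc nat_pow_closed)
  from this[of 1] this[of 2] have pow:
    "x \<otimes> (x \<otimes> y [^] (7::nat)) = x [^] (2::nat) \<otimes> y [^] (7::nat)"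
    "x \<otimes> (x [^] (2::nat) \<otimes> y [^] (7::nat)) = x [^] (3::nat) \<otimes> y [^] (7::nat)"
    using xy by (simp_all only: Suc_1 eval_nat_numeral nat_pow_eone)
  note b = basis_elem_closed[of 0 2, simplified] basis_elem_closed[of 1 2, simplified]
  have img: "h (basis_elem 2 0) = x" "h (basis_elem 2 (Suc 0)) = y"
    by (simp_all add: x_def y_def)
  show "h elem_g1 = double_delta 1 7 x y"
    using xy by (simp add: elem_g1_def Let_def double_delta_def delta_delta h.hom_conjugate h.hom_commutator
        h.hom_nat_pow b pow img)
  show "h elem_g2 = double_delta 2 7 x y"
    using xy by (simp add: elem_g2_def Let_def double_delta_def delta_delta h.hom_conjugate h.hom_commutator
        h.hom_nat_pow b pow img)
qed

lemma num_solutions_eq_card: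
  assumes u: "u \<in> carrier (free_metabelian 2)"
    and h: "\<And>h. h \<in> hom (free_metabelian 2) G \<Longrightarrow> h u = f (h (basis_elem 2 0)) (h (basis_elem 2 1))"
  shows "num_solutions 2 G u g = card {z \<in> carrier G \<times> carrier G. f (fst z) (snd z) = g}"
proof -
  have ev: "eval_at 2 G a u = f (a 0) (a 1)" if a: "a 0 \<in> carrier G" "a 1 \<in> carrier G" for a
  proof -
    have "a i \<in> carrier G" if "i < 2" for i
      using that a by (auto simp: less_2_cases_iff)
    then obtain k where k: "k \<in> hom (free_metabelian 2) G" "\<forall>i<2. k (basis_elem 2 i) = a i"
      using free_metabelian_universal[OF metabelian_group, of 2 a] by blast
    then have "eval_at 2 G a u = k u"
      using u by (intro eval_at_eqI) auto
    then show ?thesis using h[OF k(1)] k(2) by simp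
  qed
  have two: "{..<2::nat} = {0, 1}" by auto
  show ?thesis
    unfolding num_solutions_def
  proof (rule bij_betw_same_card, rule bij_betw_byWitness[where f = "\<lambda>a. (a 0, a 1)"
        and f' = "\<lambda>z. \<lambda>i\<in>{..<2}. if i = 0 then fst z else snd z"])
    show "\<forall>a\<in>{a \<in> {..<2} \<rightarrow>\<^sub>E carrier G. eval_at 2 G a u = g}.
      (\<lambda>i\<in>{..<2}. if i = 0 then fst (a 0, a 1) else snd (a 0, a 1)) = a"
      by (auto simp: fun_eq_iff restrict_def PiE_def extensional_def less_2_cases_iff)
    show "(\<lambda>a. (a 0, a 1)) ` {a \<in> {..<2} \<rightarrow>\<^sub>E carrier G. eval_at 2 G a u = g}
      \<subseteq> {z \<in> carrier G \<times> carrier G. f (fst z) (snd z) = g}"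
      using ev by (auto simp: PiE_def Pi_def)
    show "(\<lambda>z. \<lambda>i\<in>{..<2}. if i = 0 then fst z else snd z) `
        {z \<in> carrier G \<times> carrier G. f (fst z) (snd z) = g}
      \<subseteq> {a \<in> {..<2} \<rightarrow>\<^sub>E carrier G. eval_at 2 G a u = g}"
      by (auto simp: ev split: if_splits)
  qed auto
qed

lemma num_solutions_eq:
  assumes "finite (carrier G)"
  shows "num_solutions 2 G elem_g1 g = num_solutions 2 G elem_g2 g"
  using num_solutions_eq_card[OF elem_closed(1) hom_elem(1)]
    num_solutions_eq_card[OF elem_closed(2) hom_elem(2)] card_double_delta_1_2[OF assms] by simp

end

lemma num_solutions_elem_eq:
  assumes "metabelian_group G" "finite (carrier G)"
  shows "num_solutions 2 G elem_g1 g = num_solutions 2 G elem_g2 g"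
proof -
  interpret metabelian G
    using assms(1) by (simp add: metabelian_group_def metabelian_def metabelian_axioms_def)
  show ?thesis by (rule num_solutions_eq[OF assms(2)])
qed

section \<open>Homomorphisms to the affine group\<close>

lemma hom_commute_basis:
  assumes "group G" and k: "k \<in> hom (free_metabelian n) G" and g: "g \<in> carrier G"
    and comm: "\<And>i. i < n \<Longrightarrow> k (basis_elem n i) \<otimes>\<^bsub>G\<^esub> g = g \<otimes>\<^bsub>G\<^esub> k (basis_elem n i)"
    and u: "u \<in> carrier (free_metabelian n)"
  shows "k u \<otimes>\<^bsub>G\<^esub> g = g \<otimes>\<^bsub>G\<^esub> k u"
proof -
  interpret group G by fact
  have cl: "k u \<in> carrier G" if "u \<in> carrier (free_metabelian n)" for u
    using k that by (auto simp: hom_def)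
  have iff: "conjugate G a g = a \<longleftrightarrow> a \<otimes>\<^bsub>G\<^esub> g = g \<otimes>\<^bsub>G\<^esub> a" if "a \<in> carrier G" for a
    using that g by (simp add: conjugate_def m_assoc inv_solve_left')
  \<comment> \<open>Following \<open>k\<close> by conjugation with \<open>g\<close> gives another
    homomorphism with the same values on the basis, so it coincides with \<open>k\<close>.\<close>
  have "conjugate G (k u) g = k u"
  proof (rule free_metabelian_hom_eqI[OF \<open>group G\<close> _ k _ u])
    show "(\<lambda>u. conjugate G (k u) g) \<in> hom (free_metabelian n) G"
      using g cl k by (auto intro!: homI simp: conjugate_mult_left hom_mult)
  qed (use comm cl iff basis_elem_closed in auto)
  then show ?thesis using iff cl u by simp
qed

text \<open>Commutation with a fixed element spreads from the basis to all images. It is applied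
  first with the image of a basis element fixed, then with \<open>k v\<close> fixed.\<close>

lemma hom_commute:
  assumes G: "group G" and k: "k \<in> hom (free_metabelian 2) G"
    and comm: "commutator G (k (basis_elem 2 0)) (k (basis_elem 2 1)) = \<one>\<^bsub>G\<^esub>"
    and u: "u \<in> carrier (free_metabelian 2)" and v: "v \<in> carrier (free_metabelian 2)"
  shows "commutator G (k u) (k v) = \<one>\<^bsub>G\<^esub>"
proof -
  interpret group G by fact
  have cl: "k u \<in> carrier G" if "u \<in> carrier (free_metabelian 2)" for u
    using k that by (auto simp: hom_def)
  note b = basis_elem_closed[of 0 2, simplified] basis_elem_closed[of 1 2, simplified]
  have xy: "k (basis_elem 2 i) \<otimes>\<^bsub>G\<^esub> k (basis_elem 2 j) = k (basis_elem 2 j) \<otimes>\<^bsub>G\<^esub> k (basis_elem 2 i)"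
    if "i < 2" "j < 2" for i j
    using comm that b by (auto simp: less_2_cases_iff cl commutator_eq_one_iff)
  have "k w \<otimes>\<^bsub>G\<^esub> k (basis_elem 2 j) = k (basis_elem 2 j) \<otimes>\<^bsub>G\<^esub> k w"
    if "j < 2" "w \<in> carrier (free_metabelian 2)" for j w
    by (rule hom_commute_basis[OF G k cl[OF basis_elem_closed[OF that(1)]] xy[OF _ that(1)] that(2)])
  then have "k u \<otimes>\<^bsub>G\<^esub> k v = k v \<otimes>\<^bsub>G\<^esub> k u"
    by (intro hom_commute_basis[OF G k cl[OF v] _ u]) (simp add: v)
  then show ?thesis using cl u v by (simp add: commutator_eq_one_iff)
qed

text \<open>The pair \<open>(e, p)\<close> stands for the affine map \<open>z \<mapsto> 2\<^sup>e z + p\<close>, and the product of two maps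
  applies the left one first.\<close>

definition affine_group :: "(int \<times> real) monoid" where
  "affine_group = \<lparr>carrier = UNIV,
    monoid.mult = (\<lambda>(e, p) (f, q). (e + f, p * 2 powi f + q)), one = (0, 0)\<rparr>"

lemma affine_group_simps [simp]:
  "carrier affine_group = UNIV"
  "u \<otimes>\<^bsub>affine_group\<^esub> v = (fst u + fst v, snd u * 2 powi fst v + snd v)"
  "\<one>\<^bsub>affine_group\<^esub> = (0, 0)"
  by (simp_all add: affine_group_def case_prod_unfold)

lemma group_affine_group: "group affine_group"
proof (rule groupI)
  fix u :: "int \<times> real"
  show "\<exists>v\<in>carrier affine_group. v \<otimes>\<^bsub>affine_group\<^esub> u = \<one>\<^bsub>affine_group\<^esub>"
    by (rule bexI[of _ "(- fst u, - snd u * 2 powi (- fst u))"])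
      (simp_all flip: power_int_add)
qed (auto simp: power_int_add algebra_simps)

lemma affine_group_inv [simp]: "inv\<^bsub>affine_group\<^esub> u = (- fst u, - snd u * 2 powi (- fst u))"
  by (rule group.inv_equality[OF group_affine_group]) (simp_all flip: power_int_add)

text \<open>All commutators are translations, and translations commute.\<close>

interpretation aff: metabelian affine_group
proof (intro metabelian.intro group_affine_group metabelian_axioms.intro)
  interpret group affine_group by (rule group_affine_group)
  define H where "H = {u :: int \<times> real. fst u = 0}"
  have "subgroup H affine_group"
    by unfold_locales (auto simp: H_def)
  then have D: "derived affine_group (carrier affine_group) \<subseteq> H"
    unfolding derived_def by (intro generate_subgroup_incl) (auto simp: H_def)
  have "derived affine_group H \<subseteq> {\<one>\<^bsub>affine_group\<^esub>}"
    unfolding derived_def by (intro generate_subgroup_incl triv_subgroup) (auto simp: H_def)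
  then have "second_derived affine_group \<subseteq> {\<one>\<^bsub>affine_group\<^esub>}"
    using mono_derived[OF D] unfolding second_derived_def by blast
  moreover have "\<one>\<^bsub>affine_group\<^esub> \<in> second_derived affine_group"
    unfolding second_derived_def derived_def by (rule generate.one)
  ultimately show "second_derived affine_group = {\<one>\<^bsub>affine_group\<^esub>}" by blast
qed

lemma fst_affine_pow: "fst (u [^]\<^bsub>affine_group\<^esub> (n::nat)) = int n * fst u"
  by (induction n) (simp_all add: algebra_simps)

lemma affine_commutator:
  "commutator affine_group (s, p) (r, q) = (0, p * (2 powi r - 1) - q * (2 powi s - 1))"
  by (simp add: commutator_def power_int_add power_int_minus field_simps)

lemma affine_delta: "aff.delta u (0, t) = (0, t * (2 powi fst u - 1))"
  by (simp add: aff.delta_def conjugate_def power_int_add power_int_minus field_simps)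

lemma two_powi_eq_one_iff: "(2::real) powi m = 1 \<longleftrightarrow> m = 0"
  by (cases m rule: int_cases2) (use power_inject_exp[of "2::real" _ 0] in \<open>simp_all add: power_int_minus\<close>)

text \<open>The commutator is a translation, and each \<open>delta\<close> multiplies its length by
  2^e - 1, where e is the first component of the acting element. A product of reals vanishes only if
  a factor does.\<close>

lemma affine_double_delta_eq_one_iff:
  "aff.double_delta p q u v = \<one>\<^bsub>affine_group\<^esub> \<longleftrightarrow> fst u = 0 \<or> int p * fst u + int q * fst v = 0
    \<or> commutator affine_group u v = \<one>\<^bsub>affine_group\<^esub>"
proof -
  obtain t where "commutator affine_group u v = (0, t)"
    using affine_commutator[of "fst u" "snd u" "fst v" "snd v"] by simp
  then show ?thesis
    by (auto simp: aff.double_delta_def affine_delta fst_affine_pow two_powi_eq_one_iff)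
qed

section \<open>Exponent sums and the exclusion of automorphisms\<close>

lemma metabelian_integer_group: "metabelian_group integer_group"
proof -
  interpret comm_group integer_group by (rule abelian_integer_group)
  show ?thesis
    using derived_eq_singleton derived_in_carrier
    by (simp add: metabelian_group_def second_derived_def)
qed

text \<open>The universal property supplies the dual basis \<open>e 0\<close>, \<open>e 1\<close>.
  Any \<open>k\<close> and its expansion in this dual basis are homomorphisms that agree on the
  basis.\<close>

lemma exponent_sums:
  "\<exists>e :: nat \<Rightarrow> letter list set \<Rightarrow> int. (\<forall>i. e i \<in> hom (free_metabelian 2) integer_group)
    \<and> (\<forall>k \<in> hom (free_metabelian 2) integer_group. \<forall>w \<in> carrier (free_metabelian 2).
        k w = k (basis_elem 2 0) * e 0 w + k (basis_elem 2 1) * e 1 w)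
    \<and> (\<forall>i. \<forall>j<2. e i (basis_elem 2 j) = of_bool (i = j))"
proof -
  have "\<exists>h \<in> hom (free_metabelian 2) integer_group. \<forall>j<2. h (basis_elem 2 j) = of_bool (i = j)" for i
    by (rule free_metabelian_universal[OF metabelian_integer_group]) simp
  then obtain e where e: "\<And>i. e i \<in> hom (free_metabelian 2) integer_group"
    "\<And>i j. j < 2 \<Longrightarrow> e i (basis_elem 2 j) = of_bool (i = j)" by metis
  have "k w = k (basis_elem 2 0) * e 0 w + k (basis_elem 2 1) * e 1 w"
    if k: "k \<in> hom (free_metabelian 2) integer_group" and w: "w \<in> carrier (free_metabelian 2)" for k w
  proof (rule free_metabelian_hom_eqI[OF group_integer_group k _ _ w])
    show "(\<lambda>w. k (basis_elem 2 0) * e 0 w + k (basis_elem 2 1) * e 1 w)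
        \<in> hom (free_metabelian 2) integer_group"
      using e(1)[of 0] e(1)[of 1] by (auto simp: hom_def algebra_simps)
  qed (use e(2) in \<open>auto simp: less_2_cases_iff\<close>)
  then show ?thesis using e by blast
qed

text \<open>Of the four combinations of alternatives, two make the determinant 0. The other two
  force 2 to be 1 or -1 modulo 7.\<close>

lemma no_matrix:
  fixes a b c d :: int
  assumes "\<bar>a * d - b * c\<bar> = 1" "b = 0 \<or> b + 7 * d = 0"
    and "7 * a - 2 * b = 0 \<or> 7 * a - 2 * b + 7 * (7 * c - 2 * d) = 0"
  shows False
proof -
  consider "b = 0" "a = 0" | "b = 0" "a = 2 * d - 7 * c"
    | "b = - 7 * d" "a = - 2 * d" | "b = - 7 * d" "a = - 7 * c"
    using assms(2,3) by force
  then show False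
  proof cases
    case 2
    then have "\<bar>a * d\<bar> = 1" using assms(1) by simp
    then have "\<bar>a\<bar> = 1" "\<bar>d\<bar> = 1"
      using abs_zmult_eq_1[of a d] abs_zmult_eq_1[of d a] by (simp_all add: mult.commute)
    then show False using 2 by presburger
  next
    case 3
    then have "\<bar>d * (7 * c - 2 * d)\<bar> = 1" using assms(1) by (simp add: algebra_simps)
    then have "\<bar>7 * c - 2 * d\<bar> = 1" "\<bar>d\<bar> = 1"
      using abs_zmult_eq_1[of d "7 * c - 2 * d"] abs_zmult_eq_1[of "7 * c - 2 * d" d]
      by (simp_all add: mult.commute)
    then show False by presburger
  qed (use assms(1) in auto)
qed

lemma no_automorphism:
  assumes \<phi>: "\<phi> \<in> iso (free_metabelian 2) (free_metabelian 2)" and eq: "\<phi> elem_g1 = elem_g2"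
  shows False
proof -
  define M where "M = free_metabelian 2"
  interpret M: group M unfolding M_def by (rule group_free_metabelian)
  define x where "x = basis_elem 2 0"
  define y where "y = basis_elem 2 1"
  have xy: "x \<in> carrier M" "y \<in> carrier M"
    by (simp_all add: x_def y_def M_def basis_elem_closed)
  have \<phi>h: "\<phi> \<in> hom M M" and \<phi>b: "bij_betw \<phi> (carrier M) (carrier M)"
    using \<phi> by (simp_all add: M_def iso_def)
  define \<psi> where "\<psi> = inv_into (carrier M) \<phi>"
  have \<psi>h: "\<psi> \<in> hom M M"
    using M.iso_set_sym \<phi> by (auto simp: \<psi>_def M_def iso_def)
  have \<phi>\<psi>: "\<phi> (\<psi> u) = u" if "u \<in> carrier M" for u
    using \<phi>b that by (auto simp: \<psi>_def bij_betw_def f_inv_into_f)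
  have cl: "\<phi> u \<in> carrier M" "\<psi> u \<in> carrier M" if "u \<in> carrier M" for u
    using \<phi>h \<psi>h that by (auto simp: hom_def)
  obtain e :: "nat \<Rightarrow> letter list set \<Rightarrow> int" where e: "\<And>i. e i \<in> hom M integer_group"
    "\<And>k w. \<lbrakk>k \<in> hom M integer_group; w \<in> carrier M\<rbrakk> \<Longrightarrow> k w = k x * e 0 w + k y * e 1 w"
    "\<And>i j. j < 2 \<Longrightarrow> e i (basis_elem 2 j) = of_bool (i = j)"
    using exponent_sums[folded M_def x_def y_def] by metis
  have exy: "e 0 x = 1" "e 0 y = 0" "e 1 x = 0" "e 1 y = 1"
    using e(3) by (simp_all add: x_def y_def)
  have e\<phi>: "e i (\<phi> u) = e i (\<phi> x) * e 0 u + e i (\<phi> y) * e 1 u" if "u \<in> carrier M" for i u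
    using e(2)[OF hom_compose[OF \<phi>h e(1)] that] by simp
  \<comment> \<open>The rows (a, b) and (c, d) are the exponent sums of the images of x and
    y.\<close>
  define a where "a = e 0 (\<phi> x)"
  define b where "b = e 1 (\<phi> x)"
  define c where "c = e 0 (\<phi> y)"
  define d where "d = e 1 (\<phi> y)"
  have inverse: "a * e 0 (\<psi> x) + c * e 1 (\<psi> x) = 1" "b * e 0 (\<psi> x) + d * e 1 (\<psi> x) = 0"
    "a * e 0 (\<psi> y) + c * e 1 (\<psi> y) = 0" "b * e 0 (\<psi> y) + d * e 1 (\<psi> y) = 1"
    using e\<phi>[OF cl(2)[OF xy(1)], of 0] e\<phi>[OF cl(2)[OF xy(1)], of 1]
      e\<phi>[OF cl(2)[OF xy(2)], of 0] e\<phi>[OF cl(2)[OF xy(2)], of 1]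
    by (simp_all add: a_def b_def c_def d_def exy exy[unfolded One_nat_def] \<phi>\<psi> xy)
  \<comment> \<open>Multiplicativity of the determinant for the matrices of \<phi> and \<psi>, whose
    product is the identity.\<close>
  have "(a * d - b * c) * (e 0 (\<psi> x) * e 1 (\<psi> y) - e 1 (\<psi> x) * e 0 (\<psi> y))
    = (a * e 0 (\<psi> x) + c * e 1 (\<psi> x)) * (b * e 0 (\<psi> y) + d * e 1 (\<psi> y))
      - (b * e 0 (\<psi> x) + d * e 1 (\<psi> x)) * (a * e 0 (\<psi> y) + c * e 1 (\<psi> y))"
    by (simp add: algebra_simps)
  then have det: "\<bar>a * d - b * c\<bar> = 1"
    unfolding inverse by (auto simp: zmult_eq_1_iff)
  \<comment> \<open>The premise puts (s, r) on a line where \<open>elem_g2\<close> vanishes. The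
    conclusion says that its image under the matrix lies on a line where \<open>elem_g1\<close>
    vanishes.\<close>
  have key: "s * a + r * b = 0 \<or> s * a + r * b + 7 * (s * c + r * d) = 0"
    if sr: "r \<noteq> 0" "s = 0 \<or> 2 * s + 7 * r = 0" for s r :: int
  proof -
    \<comment> \<open>With translation parts 1 and 0 the commutator of the two images is the
      translation by 2^r - 1, nonzero for nonzero \<open>r\<close>.\<close>
    let ?f = "\<lambda>i::nat. if i = 0 then (s, 1) else (r, 0 :: real)"
    obtain k where k: "k \<in> hom M affine_group" "\<forall>i<2. k (basis_elem 2 i) = ?f i"
      using free_metabelian_universal[OF aff.metabelian_group, of 2 ?f] unfolding M_def by auto
    have kxy: "k x = (s, 1)" "k y = (r, 0)"
      using k(2) by (simp_all add: x_def y_def)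
    have nt: "commutator affine_group (k x) (k y) \<noteq> \<one>\<^bsub>affine_group\<^esub>"
      using sr(1) by (simp add: kxy affine_commutator two_powi_eq_one_iff)
    have k\<phi>: "(\<lambda>u. k (\<phi> u)) \<in> hom M affine_group"
      using hom_compose[OF \<phi>h k(1)] by (simp add: comp_def)
    \<comment> \<open>If the images of \<phi> x and \<phi> y commuted, then so would all values of
      \<open>k\<close> after \<phi>. As \<phi> is onto, these include \<open>k x\<close> and
      \<open>k y\<close>.\<close>
    have nt': "commutator affine_group (k (\<phi> x)) (k (\<phi> y)) \<noteq> \<one>\<^bsub>affine_group\<^esub>"
    proof
      assume "commutator affine_group (k (\<phi> x)) (k (\<phi> y)) = \<one>\<^bsub>affine_group\<^esub>"
      then have "commutator affine_group (k (\<phi> (\<psi> x))) (k (\<phi> (\<psi> y))) = \<one>\<^bsub>affine_group\<^esub>"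
        using hom_commute[OF group_affine_group k\<phi>[unfolded M_def]] cl(2)[OF xy(1)] cl(2)[OF xy(2)]
        by (simp add: M_def x_def y_def)
      then show False using nt by (simp add: \<phi>\<psi> xy)
    qed
    have "k elem_g2 = \<one>\<^bsub>affine_group\<^esub>"
      using sr(2) aff.hom_elem(2)[OF k(1)[unfolded M_def], folded x_def y_def]
          affine_double_delta_eq_one_iff[of 2 7 "k x" "k y"]
      by (auto simp: kxy)
    then have "k (\<phi> elem_g1) = \<one>\<^bsub>affine_group\<^esub>"
      using eq by simp
    then have one: "aff.double_delta 1 7 (k (\<phi> x)) (k (\<phi> y)) = \<one>\<^bsub>affine_group\<^esub>"
      using aff.hom_elem(1)[OF k\<phi>[unfolded M_def], folded x_def y_def] by simp
    have "(\<lambda>u. fst (k u)) \<in> hom M integer_group"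
      using k(1) by (auto simp: hom_def)
    then have "fst (k u) = s * e 0 u + r * e 1 u" if "u \<in> carrier M" for u
      using e(2) that by (fastforce simp: kxy)
    then have "fst (k (\<phi> x)) = s * a + r * b" "fst (k (\<phi> y)) = s * c + r * d"
      using cl xy by (simp_all add: a_def b_def c_def d_def)
    then show ?thesis
      using one nt' affine_double_delta_eq_one_iff[of 1 7 "k (\<phi> x)" "k (\<phi> y)"] by simp
  qed
  \<comment> \<open>In \<open>key\<close> the variable \<open>r\<close> comes first. The instances
    (s, r) = (0, 1) and (7, -2) take one point on each of the lines s = 0 and 2 s + 7 r = 0.\<close>
  show False
    using no_matrix[OF det] key[of 1 0] key[of "-2" 7] by simp
qed

theorem mainTheorem2:
  shows "(\<forall>G :: ('a, 'b) monoid_scheme. metabelian_group G \<and> finite (carrier G) \<longrightarrow>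
            (\<forall>g \<in> carrier G. num_solutions 2 G elem_g1 g = num_solutions 2 G elem_g2 g))
       \<and> \<not> (\<exists>\<phi> \<in> iso (free_metabelian 2) (free_metabelian 2). \<phi> elem_g1 = elem_g2)
       \<and> \<not> (\<forall>n. \<forall>u \<in> carrier (free_metabelian n). \<forall>v \<in> carrier (free_metabelian n).
              same_distribution n u v
                \<longleftrightarrow> (\<exists>\<phi> \<in> iso (free_metabelian n) (free_metabelian n). \<phi> u = v))"
proof (intro conjI allI impI ballI)
  show "num_solutions 2 G elem_g1 g = num_solutions 2 G elem_g2 g"
    if "metabelian_group G \<and> finite (carrier G)" for G :: "('a, 'b) monoid_scheme" and g
    using that by (simp add: num_solutions_elem_eq)
  show no: "\<not> (\<exists>\<phi> \<in> iso (free_metabelian 2) (free_metabelian 2). \<phi> elem_g1 = elem_g2)"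
    using no_automorphism by blast
  \<comment> \<open>The equality of counts was proved for carriers of any type, in particular for
    the groups on natural numbers quantified over here.\<close>
  have "same_distribution 2 elem_g1 elem_g2"
    by (simp add: same_distribution_def num_solutions_elem_eq)
  then show "\<not> (\<forall>n. \<forall>u \<in> carrier (free_metabelian n). \<forall>v \<in> carrier (free_metabelian n).
              same_distribution n u v
                \<longleftrightarrow> (\<exists>\<phi> \<in> iso (free_metabelian n) (free_metabelian n). \<phi> u = v))"
    using no elem_closed by blast
qed

end
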